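(* Let $A_1,A_2$ be commuting complex square matrices of the same order with $[A_1^*,A_1]=[A_2^*,A_2]$, and suppose $$\Omega=\{(x_1,x_2,x_3)\in\mathbb E:(x_1,x_2)\in\sigma_T(A_1^*+A_2x_3,\;A_2^*+A_1x_3)\}$$ is a distinguished variety in the tetrablock $\mathbb E$. If $\|A_1^*+A_2z\|_{\infty,\mathbb T}<1$, then $W=\phi(\Omega)$ is a distinguished variety in the symmetrized bidisc $\mathbb G$, where $\phi(x_1,x_2,x_3)=(x_1+x_2,x_3)$. Moreover, $\Omega$ gives rise to a distinguished variety in the bidisc $\mathbb D^2$: there is a distinguished variety $V$ in $\mathbb D^2$ with $\pi(V)=W$, where $\pi(z_1,z_2)=(z_1+z_2,z_1z_2)$.
   Context: The tetrablock is $\mathbb E=\{(x_1,x_2,x_3)\in\mathbb C^3: 1-zx_1-wx_2+zwx_3\ne0 \text{ whenever } |z|\le1,|w|\le1\}$, with distinguished (Shilov) boundary $b\mathbb E=\{(x_1,x_2,x_3)\in\overline{\mathbb E}:|x_3|=1\}$. The symmetrized bidisc is $\mathbb G=\{(z_1+z_2,z_1z_2):|z_1|<1,|z_2|<1\}\subseteq\mathbb C^2$, with distinguished boundary $b\Gamma=\{(z_1+z_2,z_1z_2):|z_1|=|z_2|=1\}$. The distinguished boundary of the bidisc $\mathbb D^2$ is $\mathbb T^2$. The map $\phi$ sends $\overline{\mathbb E}$ into $\Gamma=\overline{\mathbb G}$. A variety in a domain $G\subseteq\mathbb C^n$ is the intersection of $G$ with the common zero set of a set of polynomials in $n$ variables.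 A distinguished variety in $G$ (for $G=\mathbb E,\mathbb G,\mathbb D^2$) is a positive-dimensional variety $\Omega$ in $G$ such that $\overline\Omega\cap\partial G=\overline\Omega\cap bG$, where $\partial G$ is the topological boundary and $bG$ the distinguished boundary of $G$. $\mathbb T$ is the unit circle, $\|A_1^*+A_2z\|_{\infty,\mathbb T}=\sup_{z\in\mathbb T}\|A_1^*+A_2z\|$ (operator norm), $[S_1,S_2]=S_1S_2-S_2S_1$. $\sigma_T$ is the Taylor joint spectrum, which for a pair of commuting matrices is the set of joint eigenvalues. *)

theory Defs
  imports "HOL-Analysis.Analysis"
begin

definition holomorphic_map_on :: "(complex ^ 'n \<Rightarrow> complex ^ 'm) \<Rightarrow> (complex ^ 'n) set \<Rightarrow> bool" where
  "holomorphic_map_on f U \<longleftrightarrow>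
     (\<forall>x\<in>U. \<exists>f'. (f has_derivative f') (at x) \<and> (\<forall>c v. f' (c *s v) = c *s f' v))"

definition biholomorphic_on :: "(complex ^ 'n \<Rightarrow> complex ^ 'n) \<Rightarrow> (complex ^ 'n) set \<Rightarrow> bool" where
  "biholomorphic_on f U \<longleftrightarrow>
     open U \<and> open (f ` U) \<and> holomorphic_map_on f U \<and>
     (\<exists>g. holomorphic_map_on g (f ` U) \<and> (\<forall>x\<in>U. g (f x) = x))"

text \<open>A (not necessarily closed) complex submanifold of dimension \<open>d\<close>: near each of its points
  it is straightened by a biholomorphic chart to a coordinate subspace of dimension \<open>d\<close>.\<close>

definition complex_submanifold :: "nat \<Rightarrow> (complex ^ 'n) set \<Rightarrow> bool" where
  "complex_submanifold d M \<longleftrightarrow>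
     (\<forall>a\<in>M. \<exists>U f I. a \<in> U \<and> biholomorphic_on f U \<and> card I = d \<and>
        f ` (M \<inter> U) = {y \<in> f ` U. \<forall>i. i \<notin> I \<longrightarrow> y $ i = 0})"

text \<open>The dimension of a set is the largest dimension of a nonempty submanifold contained in it.
  For an analytic set this is the maximal dimension at its regular points. The empty set gets
  dimension \<open>0\<close>, so a set of positive dimension is nonempty.\<close>

definition complex_dim :: "(complex ^ 'n) set \<Rightarrow> nat" where
  "complex_dim S = Sup {d. \<exists>M. M \<subseteq> S \<and> M \<noteq> {} \<and> complex_submanifold d M}"

text \<open>A multi-index is a function from the index type to \<open>nat\<close>.\<close>

definition polynomial_fun :: "(complex ^ 'n \<Rightarrow> complex) \<Rightarrow> bool" where
  "polynomial_fun p \<longleftrightarrow>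
     (\<exists>(S :: ('n \<Rightarrow> nat) set) c. finite S \<and>
        (\<forall>x. p x = (\<Sum>\<alpha>\<in>S. c \<alpha> * (\<Prod>i\<in>UNIV. (x $ i) ^ \<alpha> i))))"

definition variety_in :: "(complex ^ 'n) set \<Rightarrow> (complex ^ 'n) set \<Rightarrow> bool" where
  "variety_in G V \<longleftrightarrow>
     (\<exists>P. (\<forall>p\<in>P. polynomial_fun p) \<and> V = G \<inter> {x. \<forall>p\<in>P. p x = 0})"

definition distinguished_variety ::
    "(complex ^ 'n) set \<Rightarrow> (complex ^ 'n) set \<Rightarrow> (complex ^ 'n) set \<Rightarrow> bool" where
  "distinguished_variety G bG V \<longleftrightarrow>
     variety_in G V \<and> complex_dim V > 0 \<and>
     closure V \<inter> frontier G = closure V \<inter> bG"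

definition tetrablock :: "(complex ^ 3) set" where
  "tetrablock = {x. \<forall>z w. norm z \<le> 1 \<and> norm w \<le> 1 \<longrightarrow>
      1 - z * x $ 1 - w * x $ 2 + z * w * x $ 3 \<noteq> 0}"

definition tetrablock_dbdry :: "(complex ^ 3) set" where
  "tetrablock_dbdry = {x \<in> closure tetrablock. norm (x $ 3) = 1}"

definition bidisc :: "(complex ^ 2) set" where
  "bidisc = {z. norm (z $ 1) < 1 \<and> norm (z $ 2) < 1}"

definition bidisc_dbdry :: "(complex ^ 2) set" where
  "bidisc_dbdry = {z. norm (z $ 1) = 1 \<and> norm (z $ 2) = 1}"

definition sym_map :: "complex ^ 2 \<Rightarrow> complex ^ 2" where
  "sym_map z = vector [z $ 1 + z $ 2, z $ 1 * z $ 2]"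

definition sym_bidisc :: "(complex ^ 2) set" where
  "sym_bidisc = sym_map ` bidisc"

definition sym_bidisc_dbdry :: "(complex ^ 2) set" where
  "sym_bidisc_dbdry = sym_map ` bidisc_dbdry"

definition phi_map :: "complex ^ 3 \<Rightarrow> complex ^ 2" where
  "phi_map x = vector [x $ 1 + x $ 2, x $ 3]"

definition adj :: "complex ^ 'n ^ 'm \<Rightarrow> complex ^ 'm ^ 'n" where
  "adj A = (\<chi> i j. cnj (A $ j $ i))"

definition mscale :: "complex \<Rightarrow> complex ^ 'n ^ 'm \<Rightarrow> complex ^ 'n ^ 'm" where
  "mscale c A = (\<chi> i j. c * A $ i $ j)"

definition commutator :: "complex ^ 'n ^ 'n \<Rightarrow> complex ^ 'n ^ 'n \<Rightarrow> complex ^ 'n ^ 'n" where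
  "commutator A B = A ** B - B ** A"

text \<open>For the operator norm of \<open>A\<close> with respect to the Hermitian norm on \<open>complex ^ 'n\<close>, the
  library's \<open>onorm\<close> of the map \<open>v \<mapsto> A *v v\<close> is the right notion: on this type, \<open>norm\<close> is the
  Euclidean norm.\<close>

abbreviation opnorm :: "complex ^ 'n ^ 'n \<Rightarrow> real" where
  "opnorm A \<equiv> onorm ((*v) A)"

text \<open>The Koszul complex \<open>0 \<rightarrow> H \<rightarrow> H \<oplus> H \<rightarrow> H \<rightarrow> 0\<close> of a commuting pair of matrices acting on
  \<open>H = complex ^ 'n\<close>; the Taylor spectrum consists of those \<open>(a, b)\<close> for which the Koszul complex
  of \<open>(S - a, T - b)\<close> is not exact.\<close>

definition koszul0 :: "complex ^ 'n ^ 'n \<Rightarrow> complex ^ 'n ^ 'n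
    \<Rightarrow> complex ^ 'n \<Rightarrow> (complex ^ 'n) \<times> (complex ^ 'n)" where
  "koszul0 S T v = (S *v v, T *v v)"

definition koszul1 :: "complex ^ 'n ^ 'n \<Rightarrow> complex ^ 'n ^ 'n
    \<Rightarrow> (complex ^ 'n) \<times> (complex ^ 'n) \<Rightarrow> complex ^ 'n" where
  "koszul1 S T = (\<lambda>(v, w). S *v w - T *v v)"

definition koszul_exact :: "complex ^ 'n ^ 'n \<Rightarrow> complex ^ 'n ^ 'n \<Rightarrow> bool" where
  "koszul_exact S T \<longleftrightarrow>
     inj (koszul0 S T) \<and> range (koszul0 S T) = {u. koszul1 S T u = 0} \<and> surj (koszul1 S T)"

definition taylor_spectrum :: "complex ^ 'n ^ 'n \<Rightarrow> complex ^ 'n ^ 'n \<Rightarrow> (complex \<times> complex) set" where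
  "taylor_spectrum S T = {(a, b). \<not> koszul_exact (S - mat a) (T - mat b)}"

lemma koszul_exactI:
  fixes S T :: "complex ^ 'n ^ 'n"
  assumes comm: "S ** T = T ** S"
    and ker: "\<And>v. S *v v = 0 \<Longrightarrow> T *v v = 0 \<Longrightarrow> v = 0"
  shows "koszul_exact S T"
proof -
  have linS: "linear ((*v) S)" and linT: "linear ((*v) T)"
    by (auto intro: linearI simp: matrix_vector_right_distrib
        scaleR_vec_def matrix_vector_mult_def vec_eq_iff scaleR_sum_right)
  have ST: "S *v (T *v v) = T *v (S *v v)" for v
    by (simp add: matrix_vector_mul_assoc comm)
  define P where "P k = ((*v) S) ^^ k" for k
  have linP: "linear (P k)" for k
    by (induction k) (auto simp: P_def linear_id linS intro: linear_compose[unfolded o_def]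
        simp flip: id_def simp: o_def)
  have P_Suc: "P (Suc k) v = P k (S *v v)" "P (Suc k) v = S *v P k v" for k v
    unfolding P_def by (simp_all add: funpow_swap1)
  have P_add: "P (j + k) v = P j (P k v)" for j k v
    by (simp add: P_def funpow_add)
  have PT: "P k (T *v v) = T *v P k v" for k v
    by (induction k) (auto simp: P_def ST)
  define N where "N k = {v. P k v = 0}" for k
  have subN: "subspace (N k)" for k
    unfolding N_def using linP by (rule linear_subspace_kernel)
  have TN: "v = 0" if "v \<in> N k" "T *v v = 0" for v k
    using that
  proof (induction k arbitrary: v)
    case (Suc k)
    have "S *v P k v = 0" using Suc.prems by (simp add: N_def P_Suc(2))
    moreover have "T *v P k v = 0"
      using Suc.prems PT[of k v] linear_0[OF linP] by simp
    ultimately have "v \<in> N k" using ker[of "P k v"] by (simp add: N_def)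
    then show ?case using Suc.IH[of v] Suc.prems(2) by simp
  qed (simp add: N_def P_def)
  have TN_surj: "(*v) T ` N k = N k" for k
  proof (rule subspace_dim_equal)
    show "subspace ((*v) T ` N k)" by (rule linear_subspace_image[OF linT subN])
    show "subspace (N k)" by (rule subN)
    show "(*v) T ` N k \<subseteq> N k" using PT linear_0[OF linT] by (auto simp: N_def)
    have "inj_on ((*v) T) (N k)"
      using linear_injective_on_subspace_0[OF linT subN] TN by blast
    then have "dim ((*v) T ` N k) = dim (N k)"
      using dim_image_eq[OF linT] by (metis subN span_eq_iff)
    then show "dim (N k) \<le> dim ((*v) T ` N k)" by simp
  qed
  obtain k where k: "\<And>j. dim (range (P k)) \<le> dim (range (P j))"
    using ex_has_least_nat[of "\<lambda>_. True" 0 "\<lambda>k. dim (range (P k))"] by auto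
  have stab: "range (P (Suc k + k)) = range (P k)"
  proof (rule subspace_dim_equal)
    show "subspace (range (P (Suc k + k)))" "subspace (range (P k))"
      by (intro linear_subspace_image linP subspace_UNIV)+
    show "range (P (Suc k + k)) \<subseteq> range (P k)"
      using P_add[of k "Suc k"] by (auto simp: add.commute)
  qed (rule k)
  have surj: "surj (koszul1 S T)"
  proof -
    have "\<exists>u. koszul1 S T u = x" for x
    proof -
      obtain z where z: "P k x = P (Suc k + k) z" using stab by blast
      have "P (Suc k + k) z = P k (S *v P k z)"
        by (metis P_Suc P_add add.commute)
      then have "x - S *v P k z \<in> N k"
        using z linear_diff[OF linP] by (simp add: N_def)
      then obtain u where "x - S *v P k z = T *v u" using TN_surj by blast
      then have "koszul1 S T (- u, P k z) = x"
        by (simp add: koszul1_def linear_neg[OF linT] algebra_simps)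
      then show ?thesis by blast
    qed
    then show ?thesis by (metis surjI surj_def)
  qed
  have lin0: "linear (koszul0 S T)"
    unfolding koszul0_def using linS linT
    by (auto intro!: linearI simp: linear_add linear_scale)
  have lin1: "linear (koszul1 S T)"
    unfolding koszul1_def using linS linT
    by (auto intro!: linearI simp: linear_add linear_scale algebra_simps)
  have inj: "inj (koszul0 S T)"
    using linear_injective_0[OF lin0] ker by (auto simp: koszul0_def zero_prod_def)
  have "range (koszul0 S T) = {u. koszul1 S T u = 0}"
  proof (rule subspace_dim_equal)
    show "subspace (range (koszul0 S T))"
      by (rule linear_subspace_image[OF lin0 subspace_UNIV])
    show "subspace {u. koszul1 S T u = 0}"
      by (rule linear_subspace_kernel[OF lin1])
    show "range (koszul0 S T) \<subseteq> {u. koszul1 S T u = 0}"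
      by (auto simp: koszul0_def koszul1_def ST)
    define K where "K = {u. koszul1 S T u = 0}"
    define C where "C = {u. \<forall>v\<in>K. orthogonal v u}"
    have subK: "subspace K" unfolding K_def by (rule linear_subspace_kernel[OF lin1])
    have "koszul1 S T ` C = UNIV"
    proof safe
      fix w
      obtain u where u: "w = koszul1 S T u" using surj by (metis surjD)
      obtain p q where "p \<in> span K" "\<And>v. v \<in> span K \<Longrightarrow> orthogonal q v" "u = p + q"
        using orthogonal_subspace_decomp_exists by metis
      then show "w \<in> koszul1 S T ` C"
        using u subK linear_add[OF lin1, of p q]
        by (auto simp: C_def K_def span_eq_iff[THEN iffD2] orthogonal_commute)
    qed simp
    then have "DIM(complex ^ 'n) \<le> dim C"
      using dim_image_le[OF lin1, of C] by (metis dim_UNIV)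
    moreover have "dim C + dim K = DIM((complex ^ 'n) \<times> (complex ^ 'n))"
      using dim_subspace_orthogonal_to_vectors[OF subK subspace_UNIV] by (simp add: C_def)
    moreover have "dim (range (koszul0 S T)) = DIM(complex ^ 'n)"
      using dim_image_eq[OF lin0, of UNIV] inj by simp
    ultimately show "dim {u. koszul1 S T u = 0} \<le> dim (range (koszul0 S T))"
      by (simp add: K_def)
  qed
  with inj surj show ?thesis by (simp add: koszul_exact_def)
qed

lemma taylor_spectrum_eq_joint_eigenvalues:
  fixes S T :: "complex ^ 'n ^ 'n"
  assumes "S ** T = T ** S"
  shows "taylor_spectrum S T = {(a, b). \<exists>v. v \<noteq> 0 \<and> S *v v = a *s v \<and> T *v v = b *s v}"
proof -
  have mat: "mat c *v v = c *s v" for c :: complex and v :: "complex ^ 'n"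
    by (simp add: matrix_vector_mult_def mat_def vec_eq_iff if_distrib[of "\<lambda>x. x * _"] cong: if_cong)
  have matc: "mat c ** A = A ** mat c" for c :: complex and A :: "complex ^ 'n ^ 'n"
    by (simp add: matrix_matrix_mult_def mat_def vec_eq_iff if_distrib[of "\<lambda>x. x * _"]
        if_distrib[of "\<lambda>x. _ * x"] mult.commute cong: if_cong)
  have "(S - mat a) ** (T - mat b) = (T - mat b) ** (S - mat a)" for a b
  proof -
    have "(S - mat a) ** (T - mat b) *v v = (T - mat b) ** (S - mat a) *v v" for v
      using assms matc[of a T] matc[of b S]
      by (simp add: matrix_vector_mul_assoc[symmetric] matrix_vector_mult_diff_rdistrib
          matrix_vector_mult_diff_distrib) (simp add: matrix_vector_mul_assoc matc[of a "mat b"])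
    then show ?thesis by (simp add: matrix_eq)
  qed
  moreover have "\<not> koszul_exact (S - mat a) (T - mat b)"
    if "v \<noteq> 0" "(S - mat a) *v v = 0" "(T - mat b) *v v = 0" for a b v
    using that by (auto simp: koszul_exact_def koszul0_def inj_def dest: spec[of _ 0])
  ultimately have "\<not> koszul_exact (S - mat a) (T - mat b) \<longleftrightarrow>
      (\<exists>v. v \<noteq> 0 \<and> (S - mat a) *v v = 0 \<and> (T - mat b) *v v = 0)" for a b
    using koszul_exactI by blast
  then show ?thesis
    by (simp add: taylor_spectrum_def matrix_vector_mult_diff_rdistrib mat)
qed

end

theory Submission
  imports Defs "HOL-Computational_Algebra.Fundamental_Theorem_Algebra"
begin

text \<open>
  Put \<open>F = A1 + A2\<close>. The two pencils \<open>S(p) = A1\<^sup>* + p A2\<close> and \<open>T(p) = A2\<^sup>* + p A1\<close> commute, and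
  their sum is \<open>F\<^sup>* + p F\<close>. Since every eigenvalue of a sum of commuting matrices is the sum of a
  pair of joint eigenvalues, the image of \<open>\<Omega>\<close> under \<open>(x1, x2, x3) \<mapsto> (x1 + x2, x3)\<close> can only be the
  plane curve \<open>det (F\<^sup>* + p F - s) = 0\<close> over the open disc.

  Everything else rests on one estimate for Rayleigh quotients. For a vector \<open>v\<close> let \<open>a\<close> and \<open>b\<close> be
  the conjugates of the Rayleigh quotients of \<open>A1\<close> and \<open>A2\<close> at \<open>v\<close>. The quotient of \<open>S(z)\<close> is
  \<open>a + z b\<^sup>*\<close>, where \<open>b\<^sup>*\<close> is the conjugate of \<open>b\<close>; rotating \<open>z\<close> on the circle until both summands
  are aligned, the norm bound on the circle gives \<open>|a| + |b| < 1\<close> (\<open>rayleigh_sum_less_1\<close>). If \<open>v\<close> is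
  a joint eigenvector at \<open>p\<close>, then \<open>x1 = a + b\<^sup>* p\<close> and \<open>x2 = b + a\<^sup>* p\<close>, and such points with
  \<open>|p| < 1\<close> lie in the tetrablock (\<open>tetrablock_of_parameters\<close>); hence the image of \<open>\<Omega>\<close> is the whole
  curve (\<open>phi_image_of_spectral_variety\<close>). Likewise every point of the curve has the form
  \<open>s = \<beta> + \<beta>\<^sup>* p\<close> with \<open>|\<beta>| < 1\<close>. Writing \<open>s = z + w\<close> and \<open>p = z w\<close>, this says that \<open>w\<close> is the value
  at \<open>z\<close> of a Moebius transformation that maps the open disc, the circle and the exterior of the
  closed disc to themselves. So \<open>z\<close> and \<open>w\<close> leave the disc simultaneously, which is exactly the
  boundary condition for a distinguished variety, both for the curve in the symmetrized bidisc and
  for its preimage in the bidisc.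

  Positive dimension requires a holomorphic arc in each of the two curves. Among all points of a
  plane curve \<open>Q(s, p) = 0\<close> choose one where \<open>s\<close> is a root of least multiplicity \<open>k\<close>. Roots are
  continuous, so near this point the curve is contained in the zero set of the derivative of
  \<open>Q\<close> of order \<open>k - 1\<close> with respect to \<open>s\<close>, which has a simple root there and is therefore a graph
  \<open>s = h(p)\<close> with \<open>h\<close> holomorphic (\<open>holomorphic_root_branch\<close>).
\<close>

section \<open>Polynomial functions of several variables\<close>

text \<open>
  A polynomial is given by a set of exponents, so a product expands into monomials that may share an
  exponent. Grouping a sum over an arbitrary index set by exponent takes care of this once and for all.
\<close>

lemma polynomial_fun_finite_family:
  fixes e :: "'i \<Rightarrow> 'n::finite \<Rightarrow> nat"
  assumes "finite I" and p: "\<And>x. p x = (\<Sum>i\<in>I. c i * (\<Prod>k\<in>UNIV. (x $ k) ^ e i k))"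
  shows "polynomial_fun p"
  unfolding polynomial_fun_def
proof (intro exI conjI allI)
  show "finite (e ` I)" using assms by simp
  fix x :: "complex ^ 'n"
  have "p x = (\<Sum>\<alpha>\<in>e ` I. \<Sum>i | i \<in> I \<and> e i = \<alpha>. c i * (\<Prod>k\<in>UNIV. (x $ k) ^ e i k))"
    unfolding p using \<open>finite I\<close> by (rule sum.image_gen)
  also have "\<dots> = (\<Sum>\<alpha>\<in>e ` I. (\<Sum>i | i \<in> I \<and> e i = \<alpha>. c i) * (\<Prod>k\<in>UNIV. (x $ k) ^ \<alpha> k))"
    by (simp add: sum_distrib_right)
  finally show "p x = (\<Sum>\<alpha>\<in>e ` I. (\<Sum>i | i \<in> I \<and> e i = \<alpha>. c i) * (\<Prod>k\<in>UNIV. (x $ k) ^ \<alpha> k))" .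
qed

lemma polynomial_fun_const: "polynomial_fun (\<lambda>_. c)"
  by (rule polynomial_fun_finite_family[of "{()}" _ "\<lambda>_. c" "\<lambda>_ _. 0"]) auto

lemma polynomial_fun_coord: "polynomial_fun (\<lambda>x. x $ i)"
  by (rule polynomial_fun_finite_family[of "{()}" _ "\<lambda>_. 1" "\<lambda>_ k. if k = i then 1 else 0"])
     (auto simp: if_distrib cong: if_cong)

lemma polynomial_fun_add:
  assumes "polynomial_fun p" "polynomial_fun q"
  shows "polynomial_fun (\<lambda>x. p x + q x)"
proof -
  obtain S c where 1: "finite S" "\<And>x. p x = (\<Sum>\<alpha>\<in>S. c \<alpha> * (\<Prod>i\<in>UNIV. (x $ i) ^ \<alpha> i))"
    using assms(1) unfolding polynomial_fun_def by auto
  obtain T d where 2: "finite T" "\<And>x. q x = (\<Sum>\<alpha>\<in>T. d \<alpha> * (\<Prod>i\<in>UNIV. (x $ i) ^ \<alpha> i))"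
    using assms(2) unfolding polynomial_fun_def by auto
  show ?thesis
    by (rule polynomial_fun_finite_family[of "S <+> T" _ "case_sum c d" "case_sum id id"])
       (use 1 2 in \<open>auto simp: sum.Plus\<close>)
qed

lemma polynomial_fun_mult:
  assumes "polynomial_fun p" "polynomial_fun q"
  shows "polynomial_fun (\<lambda>x. p x * q x)"
proof -
  obtain S c where 1: "finite S" "\<And>x. p x = (\<Sum>\<alpha>\<in>S. c \<alpha> * (\<Prod>i\<in>UNIV. (x $ i) ^ \<alpha> i))"
    using assms(1) unfolding polynomial_fun_def by auto
  obtain T d where 2: "finite T" "\<And>x. q x = (\<Sum>\<alpha>\<in>T. d \<alpha> * (\<Prod>i\<in>UNIV. (x $ i) ^ \<alpha> i))"
    using assms(2) unfolding polynomial_fun_def by auto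
  show ?thesis
    by (rule polynomial_fun_finite_family[of "S \<times> T" _ "\<lambda>(\<alpha>, \<beta>). c \<alpha> * d \<beta>" "\<lambda>(\<alpha>, \<beta>) i. \<alpha> i + \<beta> i"])
       (use 1 2 in \<open>auto simp: sum_product sum.cartesian_product power_add prod.distrib
          intro!: sum.cong\<close>)
qed

lemma polynomial_fun_sum:
  "(\<And>i. i \<in> I \<Longrightarrow> polynomial_fun (p i)) \<Longrightarrow> polynomial_fun (\<lambda>x. \<Sum>i\<in>I. p i x)"
  by (induction I rule: infinite_finite_induct)
     (auto intro: polynomial_fun_const polynomial_fun_add)

lemma polynomial_fun_prod:
  "(\<And>i. i \<in> I \<Longrightarrow> polynomial_fun (p i)) \<Longrightarrow> polynomial_fun (\<lambda>x. \<Prod>i\<in>I. p i x)"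
  by (induction I rule: infinite_finite_induct)
     (auto intro: polynomial_fun_const polynomial_fun_mult)

lemma polynomial_fun_det:
  assumes "\<And>i j. polynomial_fun (\<lambda>x. M x $ i $ j)"
  shows "polynomial_fun (\<lambda>x. det (M x))"
  unfolding det_def
  by (intro polynomial_fun_sum polynomial_fun_mult polynomial_fun_prod polynomial_fun_const assms)

section \<open>Holomorphic arcs in plane algebraic curves\<close>

text \<open>
  A polynomial in two variables is a polynomial in the outer variable \<open>s\<close> with coefficients in the
  inner variable \<open>p\<close>. Evaluating through the constant polynomial \<open>[:s:]\<close> is visibly a ring
  homomorphism, so it commutes with determinants; evaluating the coefficients at \<open>p\<close> first gives a
  polynomial in one variable, which has roots, orders and derivatives.
\<close>

abbreviation poly2 :: "'a::comm_ring_1 poly poly \<Rightarrow> 'a \<Rightarrow> 'a \<Rightarrow> 'a" where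
  "poly2 Q s p \<equiv> poly (poly Q [:s:]) p"

definition specialize :: "'a::comm_ring_1 \<Rightarrow> 'a poly poly \<Rightarrow> 'a poly" where
  "specialize p Q = map_poly (\<lambda>c. poly c p) Q"

lemma coeff_specialize: "coeff (specialize p Q) i = poly (coeff Q i) p"
  by (simp add: specialize_def coeff_map_poly)

lemma poly_specialize: "poly (specialize p Q) s = poly2 Q s p"
  by (induction Q) (simp_all add: specialize_def map_poly_pCons)

lemma specialize_pderiv: "specialize p (pderiv Q) = pderiv (specialize p Q)"
  by (rule poly_eqI) (simp add: coeff_specialize coeff_pderiv)

lemma specialize_higher_pderiv: "specialize p ((pderiv ^^ k) Q) = (pderiv ^^ k) (specialize p Q)"
  by (induction k) (simp_all add: specialize_pderiv)

lemma poly2_det: "poly2 (det M) s p = det (\<chi> i j. poly2 (M $ i $ j) s p)"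
  by (simp add: det_def poly_sum poly_prod)

lemma poly_higher_pderiv_at_root:
  fixes q :: "'a::field_char_0 poly"
  assumes "q \<noteq> 0" "poly q x = 0"
  shows "j < order x q \<Longrightarrow> (pderiv ^^ j) q \<noteq> 0 \<and> order x ((pderiv ^^ j) q) = order x q - j"
proof (induction j)
  case 0
  then show ?case using assms by simp
next
  case (Suc j)
  let ?r = "(pderiv ^^ j) q"
  have r: "?r \<noteq> 0" "order x ?r = order x q - j" using Suc by auto
  have "poly ?r x = 0" using r Suc.prems by (simp add: order_root)
  then have o: "order x ?r = Suc (order x (pderiv ?r))" using r order_pderiv by blast
  have "pderiv ?r \<noteq> 0"
    using \<open>poly ?r x = 0\<close> r(1) by (metis pderiv_iszero poly_pCons poly_0 mult_zero_right add_0_right pCons_0_0)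
  then show ?case using o r Suc.prems by simp
qed

text \<open>
  Divided differences of polynomials extend continuously to the diagonal. They replace the implicit
  function theorem below: a nonzero divided difference makes the root unique, and the quotient of two
  of them is the difference quotient of the root as a function of the parameter.
\<close>

lemma poly_divided_difference:
  fixes c :: "complex poly"
  shows "\<exists>L. continuous_on UNIV (\<lambda>(a, b). L a b) \<and> (\<forall>a b. poly c a - poly c b = (a - b) * L a b)"
proof (induction c)
  case 0
  then show ?case by (intro exI[of _ "\<lambda>_ _. 0"]) auto
next
  case (pCons d c)
  then obtain L where L: "continuous_on UNIV (\<lambda>(a, b). L a b)"
    "\<And>a b. poly c a - poly c b = (a - b) * L a b" by auto
  show ?case
  proof (intro exI[of _ "\<lambda>a b. poly c a + b * L a b"] conjI allI)
    show "continuous_on UNIV (\<lambda>(a, b). poly c a + b * L a b)"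
      using L(1) by (auto simp: case_prod_unfold intro!: continuous_intros)
    show "poly (pCons d c) a - poly (pCons d c) b = (a - b) * (poly c a + b * L a b)" for a b
    proof -
      have "poly (pCons d c) a - poly (pCons d c) b = (a - b) * poly c a + b * (poly c a - poly c b)"
        by (simp add: algebra_simps)
      then show ?thesis by (simp only: L(2)) (simp add: algebra_simps)
    qed
  qed
qed

lemma poly2_divided_difference:
  fixes R :: "complex poly poly"
  shows "\<exists>K L. continuous_on UNIV (\<lambda>(s, t, p). K s t p) \<and> continuous_on UNIV (\<lambda>(t, p, q). L t p q) \<and>
    (\<forall>s t p. poly2 R s p - poly2 R t p = (s - t) * K s t p) \<and>
    (\<forall>t p q. poly2 R t p - poly2 R t q = (p - q) * L t p q)"
proof (induction R)
  case 0
  then show ?case by (intro exI[of _ "\<lambda>_ _ _. 0"]) auto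
next
  case (pCons c R)
  then obtain K L where K: "continuous_on UNIV (\<lambda>(s, t, p). K s t p)"
      "\<And>s t p. poly2 R s p - poly2 R t p = (s - t) * K s t p"
    and L: "continuous_on UNIV (\<lambda>(t, p, q). L t p q)"
      "\<And>t p q. poly2 R t p - poly2 R t q = (p - q) * L t p q" by auto
  obtain M where M: "continuous_on UNIV (\<lambda>(a, b). M a b)"
    "\<And>a b. poly c a - poly c b = (a - b) * M a b"
    using poly_divided_difference[of c] by auto
  have cR: "continuous_on UNIV (\<lambda>x. poly2 R (f x) (g x))"
    if "continuous_on UNIV f" "continuous_on UNIV g" for f g :: "complex \<times> complex \<times> complex \<Rightarrow> complex"
    using that by (induction R) (auto intro!: continuous_intros)
  have cM: "continuous_on UNIV (\<lambda>x::complex \<times> complex \<times> complex. M (fst (snd x)) (snd (snd x)))"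
    using continuous_on_compose2[OF M(1) continuous_on_snd[OF continuous_on_id], of UNIV]
    by (simp add: case_prod_unfold)
  show ?case
  proof (rule exI[of _ "\<lambda>s t p. poly2 R s p + t * K s t p"],
      rule exI[of _ "\<lambda>t p q. M p q + t * L t p q"], intro conjI allI)
    show "continuous_on UNIV (\<lambda>(s, t, p). poly2 R s p + t * K s t p)"
      using K(1) by (auto simp: case_prod_unfold intro!: continuous_intros cR)
    show "continuous_on UNIV (\<lambda>(t, p, q). M p q + t * L t p q)"
      using L(1) by (auto simp: case_prod_unfold intro!: continuous_intros cM)
    show "poly2 (pCons c R) s p - poly2 (pCons c R) t p = (s - t) * (poly2 R s p + t * K s t p)" for s t p
    proof -
      have "poly2 (pCons c R) s p - poly2 (pCons c R) t p
          = (s - t) * poly2 R s p + t * (poly2 R s p - poly2 R t p)"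
        by (simp add: algebra_simps)
      then show ?thesis by (simp only: K(2)) (simp add: algebra_simps)
    qed
    show "poly2 (pCons c R) t p - poly2 (pCons c R) t q = (p - q) * (M p q + t * L t p q)" for t p q
    proof -
      have "poly2 (pCons c R) t p - poly2 (pCons c R) t q
          = (poly c p - poly c q) + t * (poly2 R t p - poly2 R t q)"
        by (simp add: algebra_simps)
      then show ?thesis by (simp only: M(2) L(2)) (simp add: algebra_simps)
    qed
  qed
qed

text \<open>
  By continuity, the value on the diagonal is the limit of the difference quotients.
\<close>

lemma poly2_divided_difference_diag:
  fixes R :: "complex poly poly"
  assumes K: "continuous_on UNIV (\<lambda>(s, t, p). K s t p)"
      "\<And>s t p. poly2 R s p - poly2 R t p = (s - t) * K s t p"
  shows "K s s p = poly2 (pderiv R) s p"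
proof -
  have "((\<lambda>t. (poly (specialize p R) t - poly (specialize p R) s) / (t - s)) \<longlongrightarrow>
      poly (pderiv (specialize p R)) s) (at s)"
    using poly_DERIV[of "specialize p R" s] by (simp add: has_field_derivative_iff)
  then have "((\<lambda>t. K t s p) \<longlongrightarrow> poly2 (pderiv R) s p) (at s)"
    unfolding specialize_pderiv[symmetric] poly_specialize K(2)
    by (rule Lim_transform_eventually) (auto simp: eventually_at_filter)
  moreover have "((\<lambda>t. K t s p) \<longlongrightarrow> K s s p) (at s)"
  proof -
    have "continuous_on UNIV (\<lambda>t. K t s p)"
    proof -
      have "continuous_on UNIV (\<lambda>t::complex. (t, s, p))" by (intro continuous_intros)
      from continuous_on_compose2[OF K(1) this] show ?thesis by simp
    qed
    then show ?thesis by (simp add: continuous_on_def)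
  qed
  ultimately show ?thesis using LIM_unique by blast
qed

text \<open>
  The modulus of \<open>q\<close> at \<open>s\<close> is that of its leading coefficient times the product of the distances
  from \<open>s\<close> to the roots. This is the continuity of roots in quantitative form.
\<close>

lemma root_within_distance:
  fixes q :: "complex poly"
  assumes "0 < e" and small: "norm (poly q s) < norm (lead_coeff q) * e ^ degree q"
  shows "\<exists>r. poly q r = 0 \<and> dist s r < e"
proof (rule ccontr)
  assume far: "\<not> ?thesis"
  have "q \<noteq> 0" using small by auto
  then obtain A where A: "size A = degree q" "q = smult (lead_coeff q) (\<Prod>x\<in>#A. [:-x, 1:])"
    using alg_closed_imp_factorization[of q] by blast
  have ev: "poly q t = lead_coeff q * (\<Prod>x\<in>#A. t - x)" for t
    by (subst A(2)) (simp add: poly_prod_mset)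
  have "e \<le> norm (s - x)" if "x \<in># A" for x
  proof -
    have "poly q x = 0" using that unfolding ev by (simp add: prod_mset_zero_iff)
    then show ?thesis using far by (auto simp: dist_norm not_less)
  qed
  then have "e ^ size A \<le> norm (\<Prod>x\<in>#A. s - x)"
    using \<open>0 < e\<close> by (induction A) (auto simp: norm_mult intro!: mult_mono)
  then have "norm (lead_coeff q) * e ^ degree q \<le> norm (poly q s)"
    unfolding ev norm_mult A(1) by (rule mult_left_mono) simp
  then show False using small by simp
qed

text \<open>
  Multiplicity can only drop when the parameter moves away, so at a point of least multiplicity
  \<open>k + 1\<close> all nearby roots have the same multiplicity and the curve is smooth. To see this, let \<open>R\<close>
  be the derivative of \<open>Q\<close> of order \<open>k\<close> in \<open>s\<close>. By minimality every zero of \<open>Q\<close> is a zero of \<open>R\<close>,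
  and \<open>R\<close> has a simple zero at the chosen point, so near it each parameter has at most one zero of
  \<open>R\<close>. By continuity of roots each nearby parameter has a zero of \<open>Q\<close>, and this defines \<open>h\<close>.
\<close>

lemma holomorphic_root_branch:
  fixes Q :: "complex poly poly"
  assumes B: "open B" "B \<noteq> {}" and deg: "degree Q > 0"
    and lead: "\<And>p. p \<in> B \<Longrightarrow> poly (lead_coeff Q) p \<noteq> 0"
  shows "\<exists>h p0 r. r > 0 \<and> ball p0 r \<subseteq> B \<and>
    (\<forall>p\<in>ball p0 r. poly2 Q (h p) p = 0 \<and> h field_differentiable (at p))"
proof -
  have degp: "degree (specialize p Q) = degree Q" if "p \<in> B" for p
  proof (rule antisym)
    show "degree (specialize p Q) \<le> degree Q"
      by (rule degree_le) (simp add: coeff_specialize coeff_eq_0)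
    show "degree Q \<le> degree (specialize p Q)"
      by (rule le_degree) (simp add: coeff_specialize lead that)
  qed
  have nz: "specialize p Q \<noteq> 0" if "p \<in> B" for p
    using degp[OF that] deg by auto
  define m where "m = (\<lambda>(s, p). order s (specialize p Q))"
  define Z where "Z = {(s, p). p \<in> B \<and> poly2 Q s p = 0}"
  obtain p1 where "p1 \<in> B" using B by blast
  moreover have "\<not> constant (poly (specialize p1 Q))"
    using degp[OF \<open>p1 \<in> B\<close>] deg by (simp add: constant_degree)
  ultimately have "\<exists>x. x \<in> Z"
    using fundamental_theorem_of_algebra[of "specialize p1 Q"] by (auto simp: Z_def poly_specialize)
  then obtain s0 p0 where Z0: "(s0, p0) \<in> Z" and min: "\<And>x. x \<in> Z \<Longrightarrow> m (s0, p0) \<le> m x"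
    using ex_has_least_nat[of "\<lambda>x. x \<in> Z" _ m] by (metis surj_pair)
  define k where "k = m (s0, p0) - 1"
  have m0: "m (s0, p0) = Suc k"
    using Z0 nz[of p0] by (auto simp: k_def m_def Z_def poly_specialize[symmetric] order_root)
  define R where "R = (pderiv ^^ k) Q"
  have ord: "order s (specialize p R) = m (s, p) - k" "specialize p R \<noteq> 0" if "(s, p) \<in> Z" for s p
    using poly_higher_pderiv_at_root[of "specialize p Q" s k] that nz[of p] min[OF that] m0
    by (auto simp: R_def specialize_higher_pderiv Z_def m_def poly_specialize)
  have R0: "poly2 R s p = 0" if "(s, p) \<in> Z" for s p
    using ord[OF that] min[OF that] m0 by (simp add: poly_specialize[symmetric] order_root)
  have R0': "poly2 (pderiv R) s0 p0 \<noteq> 0"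
  proof -
    have "order s0 (specialize p0 R) = 1" using ord[OF Z0] m0 by simp
    moreover have "poly (specialize p0 R) s0 = 0" using R0[OF Z0] by (simp add: poly_specialize)
    ultimately have "order s0 (pderiv (specialize p0 R)) = 0"
      using order_pderiv[OF ord(2)[OF Z0], of s0] by simp
    moreover have "pderiv (specialize p0 R) \<noteq> 0"
      using \<open>poly _ s0 = 0\<close> ord(2)[OF Z0]
      by (metis pderiv_iszero poly_pCons poly_0 mult_zero_right add_0_right pCons_0_0)
    ultimately show ?thesis
      by (simp add: poly_specialize[symmetric] specialize_pderiv order_root)
  qed
  obtain K L where K: "continuous_on UNIV (\<lambda>(s, t, p). K s t p)"
      "\<And>s t p. poly2 R s p - poly2 R t p = (s - t) * K s t p"
    and L: "continuous_on UNIV (\<lambda>(t, p, q). L t p q)"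
      "\<And>t p q. poly2 R t p - poly2 R t q = (p - q) * L t p q"
    using poly2_divided_difference[of R] by metis
  \<comment> \<open>A positive lower bound for the divided difference of \<open>R\<close> in \<open>s\<close> near the chosen point: it
    makes the zeros of \<open>R\<close> unique there, and Lipschitz in the parameter.\<close>
  define c where "c = norm (K s0 s0 p0) / 2"
  have K0: "K s0 s0 p0 \<noteq> 0" using poly2_divided_difference_diag[OF K] R0' by simp
  then have "c > 0" by (simp add: c_def)
  define O' where "O' = {x. c < norm (case x of (s, t, p) \<Rightarrow> K s t p)}"
  have "open O'" unfolding O'_def by (intro open_Collect_less continuous_intros K(1))
  moreover have "(s0, s0, p0) \<in> O'" using K0 by (simp add: O'_def c_def)
  ultimately obtain N1 O1 where O1: "open N1" "open O1" "(s0, s0, p0) \<in> N1 \<times> O1" "N1 \<times> O1 \<subseteq> O'"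
    by (rule open_prod_elim)
  then have "(s0, p0) \<in> O1" by simp
  with O1(2) obtain N2 C where O2: "open N2" "open C" "(s0, p0) \<in> N2 \<times> C" "N2 \<times> C \<subseteq> O1"
    by (rule open_prod_elim)
  obtain e where e: "e > 0" "ball s0 e \<subseteq> N1 \<inter> N2"
    using openE[OF open_Int[OF O1(1) O2(1)], of s0] O1(3) O2(3) by auto
  have Kc: "c < norm (K s t p)" if "s \<in> ball s0 e" "t \<in> ball s0 e" "p \<in> C" for s t p
    proof -
    have "(s, t, p) \<in> N1 \<times> O1" using that e(2) O2(4) by blast
    then show ?thesis using O1(4) by (auto simp: O'_def)
  qed
  \<comment> \<open>The parameters to which continuity of roots applies with distance \<open>e\<close>; it contains \<open>p0\<close>
    because the left-hand side vanishes there.\<close>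
  define D where "D = {p. norm (poly2 Q s0 p) < norm (poly (lead_coeff Q) p) * e ^ degree Q}"
  have "open D" unfolding D_def by (intro open_Collect_less continuous_intros)
  moreover have "p0 \<in> D" using Z0 lead[of p0] e(1) by (auto simp: D_def Z_def)
  ultimately obtain r where r: "r > 0" "ball p0 r \<subseteq> B \<inter> C \<inter> D"
    using openE[OF open_Int[OF open_Int[OF B(1) O2(2)]], of D p0] O2(3) Z0 unfolding Z_def by auto
  have "\<exists>s. s \<in> ball s0 e \<and> (s, p) \<in> Z" if "p \<in> ball p0 r" for p
  proof -
    have p: "p \<in> B" "p \<in> D" using that r(2) by auto
    have "lead_coeff (specialize p Q) = poly (lead_coeff Q) p"
      using degp[OF p(1)] by (simp add: coeff_specialize)
    then have "\<exists>s. poly (specialize p Q) s = 0 \<and> dist s0 s < e"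
      using p(2) degp[OF p(1)] e(1) by (intro root_within_distance) (auto simp: D_def poly_specialize)
    then show ?thesis using p(1) by (auto simp: Z_def poly_specialize)
  qed
  then obtain h where h: "\<And>p. p \<in> ball p0 r \<Longrightarrow> h p \<in> ball s0 e" "\<And>p. p \<in> ball p0 r \<Longrightarrow> (h p, p) \<in> Z"
    by metis
  have "h field_differentiable (at p)" if p: "p \<in> ball p0 r" for p
  proof -
    have ev: "\<forall>\<^sub>F q in at p. q \<in> ball p0 r \<and> q \<noteq> p"
      using eventually_at_in_open[OF open_ball p] by simp
    have Kq: "c < norm (K (h q) (h p) q)" if "q \<in> ball p0 r" for q
      using Kc h(1) that p r(2) by blast
    \<comment> \<open>Both \<open>(h q, q)\<close> and \<open>(h p, p)\<close> are zeros of \<open>R\<close>; pass from one to the other through \<open>(h p, q)\<close>.\<close>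
    have diff: "(h q - h p) * K (h q) (h p) q = - ((q - p) * L (h p) q p)" if "q \<in> ball p0 r" for q
    proof -
      have "(h q - h p) * K (h q) (h p) q + (q - p) * L (h p) q p = poly2 R (h q) q - poly2 R (h p) p"
        by (simp flip: K(2) L(2))
      also have "\<dots> = 0" using R0 h(2) that p by simp
      finally show ?thesis by (simp add: eq_neg_iff_add_eq_0)
    qed
    have cL: "((\<lambda>q. L (h p) q p) \<longlongrightarrow> L (h p) p p) (at p)"
    proof -
      have "continuous_on UNIV (\<lambda>q::complex. (h p, q, p))" by (intro continuous_intros)
      from continuous_on_compose2[OF L(1) this] show ?thesis by (simp add: continuous_on_def)
    qed
    have "((\<lambda>q. h q - h p) \<longlongrightarrow> 0) (at p)"
    proof (rule Lim_null_comparison)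
      show "\<forall>\<^sub>F q in at p. norm (h q - h p) \<le> norm ((q - p) * L (h p) q p) / c"
        using ev
      proof eventually_elim
        case (elim q)
        have "norm (h q - h p) * c \<le> norm (h q - h p) * norm (K (h q) (h p) q)"
          using Kq elim by (intro mult_left_mono) (auto simp: less_imp_le)
        also have "\<dots> = norm ((q - p) * L (h p) q p)"
          using diff[of q] elim by (metis norm_minus_cancel norm_mult)
        finally show ?case using \<open>c > 0\<close> by (simp add: field_simps)
      qed
      have "((\<lambda>q. norm ((q - p) * L (h p) q p) / c) \<longlongrightarrow> norm ((p - p) * L (h p) p p) / c) (at p)"
        using \<open>c > 0\<close> by (intro tendsto_intros cL) auto
      then show "((\<lambda>q. norm ((q - p) * L (h p) q p) / c) \<longlongrightarrow> 0) (at p)" by simp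
    qed
    then have "(h \<longlongrightarrow> h p) (at p)" by (simp add: LIM_zero_iff)
    then have "((\<lambda>q. (h q, h p, q)) \<longlongrightarrow> (h p, h p, p)) (at p)" by (intro tendsto_intros)
    then have cK: "((\<lambda>q. K (h q) (h p) q) \<longlongrightarrow> K (h p) (h p) p) (at p)"
      using continuous_on_tendsto_compose[OF K(1), of "\<lambda>q. (h q, h p, q)" "(h p, h p, p)" "at p"] by simp
    have "((\<lambda>q. - L (h p) q p / K (h q) (h p) q) \<longlongrightarrow> - L (h p) p p / K (h p) (h p) p) (at p)"
      using Kq[OF p] \<open>c > 0\<close> by (intro tendsto_intros cL cK) auto
    moreover have "\<forall>\<^sub>F q in at p. - L (h p) q p / K (h q) (h p) q = (h q - h p) / (q - p)"
      using ev
    proof eventually_elim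
      case (elim q)
      then have "K (h q) (h p) q \<noteq> 0" "q - p \<noteq> 0" using Kq[of q] \<open>c > 0\<close> by auto
      moreover have "- L (h p) q p * (q - p) = (h q - h p) * K (h q) (h p) q"
        using diff[of q] elim by (simp add: mult.commute)
      ultimately show ?case using frac_eq_eq by metis
    qed
    ultimately have "((\<lambda>q. (h q - h p) / (q - p)) \<longlongrightarrow> - L (h p) p p / K (h p) (h p) p) (at p)"
      by (rule Lim_transform_eventually)
    then show ?thesis unfolding field_differentiable_def has_field_derivative_iff by blast
  qed
  then show ?thesis using h(2) r by (auto simp: Z_def intro!: exI[of _ h] exI[of _ p0] exI[of _ r])
qed

text \<open>
  If the roots stay bounded, then \<open>Q\<close> is not constant in \<open>s\<close>: otherwise every \<open>s\<close> would be a root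
  over \<open>p1\<close>. The leading coefficient vanishes at finitely many parameters, and over the remaining ones
  there is a holomorphic branch.
\<close>

lemma root_branch_of_bounded_roots:
  fixes Q :: "complex poly poly"
  assumes D: "open D" "p1 \<in> D" and root: "poly2 Q s1 p1 = 0"
    and bound: "\<And>s p. p \<in> D \<Longrightarrow> poly2 Q s p = 0 \<Longrightarrow> norm s < b"
  shows "\<exists>h p0 r. r > 0 \<and> ball p0 r \<subseteq> D \<and>
    (\<forall>p\<in>ball p0 r. poly2 Q (h p) p = 0 \<and> h field_differentiable (at p))"
proof -
  have deg: "degree Q > 0"
  proof (rule ccontr)
    assume "\<not> degree Q > 0"
    then obtain c where "Q = [:c:]" using degree_eq_zeroE by blast
    then show False using root bound[OF D(2), of "of_real (max b 0)"] by auto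
  qed
  define B where "B = {p \<in> D. poly (lead_coeff Q) p \<noteq> 0}"
  have lead: "lead_coeff Q \<noteq> 0" using deg by auto
  have fin: "finite {p. poly (lead_coeff Q) p = 0}" using lead by (rule poly_roots_finite)
  have B: "B = D - {p. poly (lead_coeff Q) p = 0}" by (auto simp: B_def)
  have "open B" unfolding B using D(1) fin by (simp add: open_Diff finite_imp_closed)
  moreover have "B \<noteq> {}"
  proof
    assume "B = {}"
    then have "finite D" using fin unfolding B by (metis Diff_eq_empty_iff finite_subset)
    then show False using D using finite_imp_not_open by blast
  qed
  ultimately show ?thesis
    using holomorphic_root_branch[of B Q] deg unfolding B_def by blast
qed

section \<open>Graphs as one-dimensional submanifolds\<close>

lemma complex_submanifold_dim_le:
  assumes "complex_submanifold d (M :: (complex ^ 'n) set)" "M \<noteq> {}"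
  shows "d \<le> CARD('n)"
proof -
  obtain I :: "'n set" where "card I = d"
    using assms unfolding complex_submanifold_def by blast
  then show ?thesis using card_mono[of UNIV I] by simp
qed

text \<open>
  Dimensions of submanifolds are bounded by the number of coordinates, so the supremum that defines
  the dimension of a set is attained and one arc is enough.
\<close>

lemma complex_dim_pos:
  fixes M :: "(complex ^ 'n) set"
  assumes "complex_submanifold 1 M" "M \<noteq> {}" "M \<subseteq> S"
  shows "complex_dim S > 0"
proof -
  let ?D = "{d. \<exists>M. M \<subseteq> S \<and> M \<noteq> {} \<and> complex_submanifold d M}"
  have "bdd_above ?D" by (rule bdd_aboveI[of _ "CARD('n)"]) (auto dest: complex_submanifold_dim_le)
  moreover have "1 \<in> ?D" using assms by blast
  ultimately have "1 \<le> Sup ?D" by (rule cSup_upper[rotated])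
  then show ?thesis by (simp add: complex_dim_def)
qed

text \<open>
  Shears along a coordinate direction are the charts that straighten graphs.
\<close>

lemma has_derivative_shear:
  fixes h :: "complex \<Rightarrow> complex" and i j :: "'n::finite"
  assumes "h field_differentiable (at (x $ j))"
  shows "\<exists>f'. ((\<lambda>x. x + axis i (h (x $ j))) has_derivative f') (at x) \<and> (\<forall>c v. f' (c *s v) = c *s f' v)"
proof -
  obtain D where D: "(h has_field_derivative D) (at (x $ j))"
    using assms field_differentiable_def by blast
  have lin: "bounded_linear (axis i :: complex \<Rightarrow> complex ^ 'n)"
    by (auto intro!: linearI simp: linear_conv_bounded_linear[symmetric] axis_def vec_eq_iff)
  have "((\<lambda>x. h (x $ j)) has_derivative (\<lambda>v. D * (v $ j))) (at x)"
    using has_derivative_compose[OF bounded_linear_imp_has_derivative[OF bounded_linear_vec_nth]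
      D[unfolded has_field_derivative_def]] by simp
  then have "((\<lambda>x. axis i (h (x $ j))) has_derivative (\<lambda>v. axis i (D * (v $ j)))) (at x)"
    by (rule bounded_linear.has_derivative[OF lin])
  then have "((\<lambda>x. x + axis i (h (x $ j))) has_derivative (\<lambda>v. v + axis i (D * (v $ j)))) (at x)"
    by (intro derivative_intros)
  moreover have "c *s v + axis i (D * ((c *s v) $ j)) = c *s (v + axis i (D * (v $ j)))" for c v
    by (simp add: vec_eq_iff axis_def distrib_left)
  ultimately show ?thesis by blast
qed

lemma graph_complex_submanifold:
  fixes h :: "complex \<Rightarrow> complex" and i j :: "'n::finite"
  assumes ij: "i \<noteq> j" "UNIV = {i, j}" and "open B"
    and h: "\<And>p. p \<in> B \<Longrightarrow> h field_differentiable (at p)"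
  shows "complex_submanifold 1 {x :: complex ^ 'n. x $ j \<in> B \<and> x $ i = h (x $ j)}"
    (is "complex_submanifold 1 ?M")
proof -
  define U where "U = {x :: complex ^ 'n. x $ j \<in> B}"
  define f where "f = (\<lambda>x :: complex ^ 'n. x + axis i (- h (x $ j)))"
  define g where "g = (\<lambda>x :: complex ^ 'n. x + axis i (h (x $ j)))"
  have j: "f x $ j = x $ j" "g x $ j = x $ j" for x
    using ij by (simp_all add: f_def g_def axis_def)
  have gf: "g (f x) = x" "f (g x) = x" for x
    unfolding f_def g_def using ij by (simp_all add: axis_def vec_eq_iff)
  have fU: "f ` U = U"
  proof
    show "f ` U \<subseteq> U" by (auto simp: U_def j)
    show "U \<subseteq> f ` U" using gf(2) j(2) by (metis (mono_tags, lifting) U_def image_iff mem_Collect_eq subsetI)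
  qed
  have "open U"
    unfolding U_def using open_vimage_vec_nth[OF \<open>open B\<close>, of j] by (simp add: vimage_def)
  have "biholomorphic_on f U"
    unfolding biholomorphic_on_def fU
  proof (intro conjI exI ballI)
    show "open U" "open U" by fact+
    show "holomorphic_map_on f U" "holomorphic_map_on g U"
      unfolding holomorphic_map_on_def f_def g_def
      by (auto simp: U_def intro!: has_derivative_shear h field_differentiable_minus)
    show "g (f x) = x" for x by (rule gf)
  qed
  moreover have "f ` (?M \<inter> U) = {y \<in> f ` U. \<forall>k. k \<notin> {j} \<longrightarrow> y $ k = 0}"
  proof -
    have i0: "f x $ i = 0 \<longleftrightarrow> x $ i = h (x $ j)" for x by (simp add: f_def axis_def)
    have all: "(\<forall>k. k \<notin> {j} \<longrightarrow> P k) \<longleftrightarrow> P i" for P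
      using ij by (metis (no_types) UNIV_I insertE singletonI singletonD)
    show ?thesis unfolding all using i0 by (auto simp: U_def)
  qed
  ultimately show ?thesis
    unfolding complex_submanifold_def
    by (intro ballI exI[of _ U] exI[of _ f] exI[of _ "{j}"]) (auto simp: U_def)
qed

section \<open>Joint eigenvectors of commuting matrices\<close>

text \<open>
  This turns the spectral condition into a polynomial equation.
\<close>

lemma det_zero_iff_kernel:
  fixes A :: "'a::field ^ 'n ^ 'n"
  shows "det A = 0 \<longleftrightarrow> (\<exists>v. v \<noteq> 0 \<and> A *v v = 0)"
  using invertible_det_nz[of A] matrix_left_invertible_ker[of A]
  by (metis invertible_def matrix_left_right_inverse)

text \<open>
  The value \<open>q(S) v\<close> by Horner's scheme, without forming the powers of the matrix \<open>S\<close>.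
\<close>

definition poly_action :: "'a::field ^ 'n ^ 'n \<Rightarrow> 'a poly \<Rightarrow> 'a ^ 'n \<Rightarrow> 'a ^ 'n" where
  "poly_action S q v = fold_coeffs (\<lambda>a w. a *s v + S *v w) q 0"

lemma poly_action_0: "poly_action S 0 v = 0"
  by (simp add: poly_action_def)

lemma poly_action_pCons: "poly_action S (pCons a q) v = a *s v + S *v poly_action S q v"
  by (cases "q = 0 \<and> a = 0") (auto simp: poly_action_def)

lemma poly_action_add: "poly_action S (p + q) v = poly_action S p v + poly_action S q v"
  by (induction p q rule: poly_induct2)
     (simp_all add: poly_action_0 poly_action_pCons vec.scale_left_distrib matrix_vector_right_distrib)

lemma poly_action_smult: "poly_action S (smult c q) v = c *s poly_action S q v"
  by (induction q)
     (simp_all add: poly_action_0 poly_action_pCons vec.scale_right_distrib vector_scalar_commute)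

lemma poly_action_linear:
  "poly_action S q (v + w) = poly_action S q v + poly_action S q w"
  "poly_action S q (c *s v) = c *s poly_action S q v"
  by (induction q)
     (simp_all add: poly_action_0 poly_action_pCons vec.scale_right_distrib matrix_vector_right_distrib
      vector_scalar_commute mult.commute)

lemma poly_action_apply: "poly_action S q (S *v v) = S *v poly_action S q v"
  by (induction q)
     (simp_all add: poly_action_0 poly_action_pCons matrix_vector_right_distrib vector_scalar_commute)

lemma poly_action_root_factor:
  "poly_action S ([:-r, 1:] * q) v = poly_action S q (S *v v - r *s v)"
proof -
  have "poly_action S ([:-r, 1:] * q) v = S *v poly_action S q v - r *s poly_action S q v"
  proof -
    have "[:-r, 1:] * q = smult (- r) q + pCons 0 q" by simp
    then show ?thesis
      by (simp only: poly_action_add poly_action_smult poly_action_pCons) simp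
  qed
  also have "\<dots> = poly_action S q (S *v v + (- r) *s v)"
    unfolding poly_action_linear poly_action_apply by simp
  finally show ?thesis by simp
qed

text \<open>
  The vectors \<open>v, S v, S\<^sup>2 v, \<dots>\<close> are more numerous than the dimension, so they satisfy a linear
  relation.
\<close>

lemma annihilating_polynomial:
  fixes S :: "'a::field ^ 'n ^ 'n"
  shows "\<exists>q. q \<noteq> 0 \<and> poly_action S q v = 0"
proof (rule ccontr)
  assume *: "\<not> ?thesis"
  define P where "P = (\<lambda>k. poly_action S (monom 1 k) v)"
  have act: "poly_action S (\<Sum>k\<in>K. monom (c k) k) v = (\<Sum>k\<in>K. c k *s P k)" if "finite K" for K c
    using that
  proof (induction K)
    case (insert k K)
    have "monom (c k) k = smult (c k) (monom 1 k)" by (simp add: smult_monom)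
    then have "poly_action S (monom (c k) k) v = c k *s P k"
      by (simp only: poly_action_smult P_def)
    then show ?case using insert by (simp add: poly_action_add)
  qed (simp add: poly_action_0)
  have inj: "inj P"
  proof (rule injI, rule ccontr)
    fix i j assume "P i = P j" "i \<noteq> j"
    then have "poly_action S (monom 1 i + smult (-1) (monom 1 j)) v = 0"
      unfolding poly_action_add poly_action_smult by (simp add: P_def)
    moreover have "coeff (monom 1 i + smult (-1) (monom (1::'a) j)) i = 1"
      using \<open>i \<noteq> j\<close> by simp
    ultimately show False using * by (metis coeff_0 zero_neq_one)
  qed
  define N where "N = vec.dim (UNIV :: ('a ^ 'n) set)"
  have "vec.independent (P ` {..N})"
  proof (rule vec.independent_if_scalars_zero)
    fix f x assume "(\<Sum>x\<in>P ` {..N}. f x *s x) = 0" and "x \<in> P ` {..N}"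
    then obtain k where k: "x = P k" "k \<le> N" by auto
    have "(\<Sum>x\<in>P ` {..N}. f x *s x) = poly_action S (\<Sum>k\<le>N. monom (f (P k)) k) v"
      by (subst sum.reindex) (use inj in \<open>auto simp: act inj_on_def\<close>)
    then have "(\<Sum>k\<le>N. monom (f (P k)) k) = 0"
      using * \<open>_ = 0\<close> by metis
    then have "coeff (\<Sum>k\<le>N. monom (f (P k)) k) k = 0" by simp
    then show "f x = 0" using k by (simp add: coeff_sum if_distrib cong: if_cong)
  qed auto
  then have "card (P ` {..N}) \<le> N"
    using vec.independent_card_le_dim[of "P ` {..N}" UNIV] N_def by auto
  then show False using inj by (simp add: card_image inj_on_def)
qed

text \<open>
  Split linear factors \<open>S - r\<close> off a polynomial that annihilates \<open>v\<close> and apply them to \<open>v\<close> one after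
  the other. The vector stays in \<open>E\<close>, and the last nonzero vector before the result is \<open>0\<close> is an
  eigenvector.
\<close>

lemma invariant_subspace_has_eigenvector:
  fixes S :: "complex ^ 'n ^ 'n"
  assumes sub: "vec.subspace E" and inv: "\<And>v. v \<in> E \<Longrightarrow> S *v v \<in> E"
    and v: "v \<in> E" "v \<noteq> 0"
  shows "\<exists>w\<in>E. w \<noteq> 0 \<and> (\<exists>r. S *v w = r *s w)"
proof -
  obtain q where q: "q \<noteq> 0" "poly_action S q v = 0" using annihilating_polynomial by blast
  then show ?thesis using v
  proof (induction "degree q" arbitrary: q v)
    case 0
    then obtain c where "q = [:c:]" by (metis degree_eq_zeroE)
    then show ?case using 0 by (auto simp: poly_action_pCons poly_action_0)
  next
    case (Suc n)
    then have "\<not> constant (poly q)" by (simp add: constant_degree)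
    then obtain r where "poly q r = 0" using fundamental_theorem_of_algebra by blast
    then obtain q' where q': "q = [:-r, 1:] * q'" using poly_eq_0_iff_dvd dvdE by metis
    define w where "w = S *v v - r *s v"
    show ?case
    proof (cases "w = 0")
      case True then show ?thesis using Suc.prems unfolding w_def by auto
    next
      case False
      have nz: "q' \<noteq> 0" using Suc.prems q' by auto
      have "degree q = Suc (degree q')" unfolding q' using nz by (subst degree_mult_eq) auto
      moreover have "poly_action S q' w = 0"
        using Suc.prems(2) unfolding w_def q' poly_action_root_factor .
      moreover have "w \<in> E"
        unfolding w_def using sub inv Suc.prems vec.subspace_diff vec.subspace_scale by blast
      ultimately show ?thesis using Suc.hyps(1)[of q' w] Suc.hyps(2) False nz by auto
    qed
  qed
qed

text \<open>
  The eigenspace of \<open>S + T\<close> is invariant under \<open>S\<close>, so it contains an eigenvector of \<open>S\<close>, which is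
  then an eigenvector of \<open>T = (S + T) - S\<close> as well.
\<close>

lemma joint_eigenvector_of_sum:
  fixes S T :: "complex ^ 'n ^ 'n"
  assumes comm: "S ** T = T ** S" and v: "v \<noteq> 0" "(S + T) *v v = s *s v"
  shows "\<exists>w a b. w \<noteq> 0 \<and> S *v w = a *s w \<and> T *v w = b *s w \<and> a + b = s"
proof -
  define E where "E = {w. (S + T) *v w = s *s w}"
  have "vec.subspace E"
    by (auto simp: E_def vec.subspace_def matrix_vector_right_distrib vec.scale_right_distrib
        vector_scalar_commute mult.commute)
  moreover have "S *v w \<in> E" if "w \<in> E" for w
  proof -
    have "(S + T) *v (S *v w) = S *v ((S + T) *v w)"
      using comm
      by (simp add: matrix_vector_mult_add_rdistrib matrix_vector_right_distrib)
         (simp add: matrix_vector_mul_assoc)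
    then show ?thesis using that by (simp add: E_def vector_scalar_commute)
  qed
  ultimately obtain w a where w: "w \<in> E" "w \<noteq> 0" "S *v w = a *s w"
    using invariant_subspace_has_eigenvector[of E S v] v by (auto simp: E_def)
  then have "T *v w = (s - a) *s w"
    by (simp add: E_def matrix_vector_mult_add_rdistrib vec.scale_left_diff_distrib algebra_simps)
  then show ?thesis using w by (metis add_diff_cancel_left' add_diff_eq)
qed

section \<open>Rayleigh quotients\<close>

definition cinner :: "complex ^ 'n \<Rightarrow> complex ^ 'n \<Rightarrow> complex" where
  "cinner v w = (\<Sum>i\<in>UNIV. v $ i * cnj (w $ i))"

lemma cinner_self: "cinner v v = of_real ((norm v)\<^sup>2)"
proof -
  have "(norm v)\<^sup>2 = (\<Sum>i\<in>UNIV. (norm (v $ i))\<^sup>2)"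
    by (simp add: norm_vec_def L2_set_def sum_nonneg)
  then show ?thesis by (simp only: of_real_sum complex_norm_square cinner_def)
qed

lemma norm_cinner_le: "norm (cinner v w) \<le> norm v * norm w"
proof -
  have "norm (cinner v w) \<le> (\<Sum>i\<in>UNIV. \<bar>norm (v $ i)\<bar> * \<bar>norm (w $ i)\<bar>)"
    unfolding cinner_def by (rule order_trans[OF norm_sum]) (simp add: norm_mult)
  also have "\<dots> \<le> norm v * norm w"
    unfolding norm_vec_def by (rule L2_set_mult_ineq)
  finally show ?thesis .
qed

text \<open>
  At \<open>v = 0\<close> the value is \<open>0 / 0 = 0\<close>, so the bounds below hold for all \<open>v\<close>.
\<close>

definition rayleigh :: "complex ^ 'n ^ 'n \<Rightarrow> complex ^ 'n \<Rightarrow> complex" where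
  "rayleigh A v = cinner (A *v v) v / cinner v v"

lemma mscale_mult_vec: "mscale c A *v v = c *s (A *v v)"
  by (simp add: mscale_def matrix_vector_mult_def vec_eq_iff sum_distrib_left mult.assoc)

lemma rayleigh_add: "rayleigh (A + B) v = rayleigh A v + rayleigh B v"
  by (simp add: rayleigh_def cinner_def matrix_vector_mult_add_rdistrib add_divide_distrib[symmetric]
      distrib_right sum.distrib)

lemma rayleigh_mscale: "rayleigh (mscale c A) v = c * rayleigh A v"
  by (simp add: rayleigh_def cinner_def mscale_mult_vec sum_distrib_left mult.assoc)

lemma rayleigh_adj: "rayleigh (adj A) v = cnj (rayleigh A v)"
proof -
  have "cinner (adj A *v v) v = (\<Sum>i\<in>UNIV. \<Sum>j\<in>UNIV. cnj (A $ j $ i) * v $ j * cnj (v $ i))"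
    by (simp add: cinner_def adj_def matrix_vector_mult_def sum_distrib_right)
  also have "\<dots> = (\<Sum>j\<in>UNIV. \<Sum>i\<in>UNIV. cnj (A $ j $ i) * v $ j * cnj (v $ i))"
    by (rule sum.swap)
  also have "\<dots> = cnj (cinner (A *v v) v)"
    by (simp add: cinner_def matrix_vector_mult_def sum_distrib_right sum_distrib_left mult_ac)
  finally show ?thesis by (simp add: rayleigh_def cinner_self)
qed

lemma rayleigh_eigenvector: "v \<noteq> 0 \<Longrightarrow> A *v v = a *s v \<Longrightarrow> rayleigh A v = a"
proof -
  assume v: "v \<noteq> 0" "A *v v = a *s v"
  then have "cinner (A *v v) v = a * cinner v v"
    by (simp add: cinner_def sum_distrib_left mult.assoc)
  then show ?thesis using v by (simp add: rayleigh_def cinner_self)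
qed

lemma norm_rayleigh_le: "norm (rayleigh A v) \<le> opnorm A"
proof (cases "v = 0")
  case True
  then show ?thesis using onorm_pos_le[OF matrix_vector_mul_bounded_linear[of A]]
    by (simp add: rayleigh_def cinner_def)
next
  case False
  have "norm (cinner (A *v v) v) \<le> norm (A *v v) * norm v" by (rule norm_cinner_le)
  also have "\<dots> \<le> (opnorm A * norm v) * norm v"
    by (intro mult_right_mono onorm matrix_vector_mul_bounded_linear) auto
  finally show ?thesis using False
    by (simp add: rayleigh_def cinner_self norm_divide field_simps power2_eq_square norm_mult)
qed

lemma unimodular_alignment: "\<exists>z. norm z = 1 \<and> norm (a + z * b) = norm a + norm (b :: complex)"
proof -
  have "\<exists>z. norm z = 1 \<and> (a + z * b) = u * of_real (norm a + norm b)"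
    if "norm u = 1" "a = u * of_real (norm a)" for u
  proof (cases "b = 0")
    case True then show ?thesis using that by (intro exI[of _ 1]) auto
  next
    case False
    then have "norm (u * of_real (norm b) / b) = 1"
      "a + (u * of_real (norm b) / b) * b = u * of_real (norm a + norm b)"
      using that by (simp_all add: norm_mult norm_divide distrib_left)
    then show ?thesis by blast
  qed
  moreover have "\<exists>u. norm u = 1 \<and> a = u * of_real (norm a)"
  proof (cases "a = 0")
    case True then show ?thesis by (intro exI[of _ 1]) auto
  next
    case False then show ?thesis by (intro exI[of _ "a / of_real (norm a)"]) (auto simp: norm_divide)
  qed
  ultimately obtain u z where u: "norm u = 1" "norm z = 1" "a + z * b = u * of_real (norm a + norm b)" by metis
  have "norm (a + z * b) = \<bar>norm a + norm b\<bar>"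
    unfolding u(3) norm_mult u(1) norm_of_real by simp
  then show ?thesis using u(2) by auto
qed

text \<open>
  A supremum of real numbers bounds its terms only if they are bounded above, which holds here by the
  triangle inequality.
\<close>

lemma opnorm_less_of_SUP_less:
  fixes A B :: "complex ^ 'n ^ 'n"
  assumes "(SUP z\<in>sphere 0 1. opnorm (A + mscale z B)) < 1" "norm z = 1"
  shows "opnorm (A + mscale z B) < 1"
proof -
  have "opnorm (A + mscale w B) \<le> opnorm A + opnorm B" if "norm w = 1" for w
  proof (rule onorm_le)
    fix v
    have "norm ((A + mscale w B) *v v) \<le> norm (A *v v) + norm (B *v v)"
    proof -
      have "norm (w *s (B *v v)) = norm (B *v v)"
        using that by (simp add: norm_vec_def norm_mult)
      then show ?thesis
        using norm_triangle_ineq[of "A *v v" "w *s (B *v v)"]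
        by (simp add: matrix_vector_mult_add_rdistrib mscale_mult_vec)
    qed
    also have "\<dots> \<le> opnorm A * norm v + opnorm B * norm v"
      by (intro add_mono onorm matrix_vector_mul_bounded_linear)
    finally show "norm ((A + mscale w B) *v v) \<le> (opnorm A + opnorm B) * norm v"
      by (simp add: distrib_right)
  qed
  then have "bdd_above ((\<lambda>z. opnorm (A + mscale z B)) ` sphere 0 1)"
    by (intro bdd_aboveI[of _ "opnorm A + opnorm B"]) auto
  then have "opnorm (A + mscale z B) \<le> (SUP z\<in>sphere 0 1. opnorm (A + mscale z B))"
    using assms(2) by (intro cSUP_upper) auto
  then show ?thesis using assms(1) by simp
qed

text \<open>
  The Rayleigh quotient of \<open>A1\<^sup>* + z A2\<close> is the conjugate of that of \<open>A1\<close> plus \<open>z\<close> times that of \<open>A2\<close>.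
  For a suitable \<open>z\<close> on the circle the modulus of this sum is the sum of the moduli.
\<close>

lemma rayleigh_sum_less_1:
  fixes A1 A2 :: "complex ^ 'n ^ 'n"
  assumes small: "\<And>z. norm z = 1 \<Longrightarrow> opnorm (adj A1 + mscale z A2) < 1"
  shows "norm (rayleigh A1 v) + norm (rayleigh A2 v) < 1"
proof -
  obtain z where z: "norm z = 1"
    "norm (cnj (rayleigh A1 v) + z * rayleigh A2 v) = norm (cnj (rayleigh A1 v)) + norm (rayleigh A2 v)"
    using unimodular_alignment by blast
  have "norm (rayleigh A1 v) + norm (rayleigh A2 v) = norm (rayleigh (adj A1 + mscale z A2) v)"
    unfolding rayleigh_add rayleigh_mscale rayleigh_adj z(2) by simp
  also have "\<dots> < 1" using norm_rayleigh_le small[OF z(1)] by (rule le_less_trans)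
  finally show ?thesis .
qed

section \<open>The pencils and their characteristic polynomial\<close>

lemma mscale_mult:
  "mscale c A ** B = mscale c (A ** B)" "A ** mscale c B = mscale c (A ** B)"
  by (simp_all add: mscale_def matrix_matrix_mult_def vec_eq_iff sum_distrib_left mult_ac)

lemma mscale_add: "mscale c (A + B) = mscale c A + mscale c B"
  by (simp add: mscale_def vec_eq_iff distrib_left)

lemma adj_mult: "adj (A ** B) = adj B ** adj A"
  by (simp add: adj_def matrix_matrix_mult_def vec_eq_iff mult.commute)

lemma adj_add: "adj (A + B) = adj A + adj B"
  by (simp add: adj_def vec_eq_iff)

text \<open>
  In the difference of the two products the coefficients of \<open>1\<close> and \<open>p\<^sup>2\<close> vanish because \<open>A1\<close> and \<open>A2\<close>
  commute, and the coefficient of \<open>p\<close> is the difference of the two self-commutators.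
\<close>

lemma pencils_commute:
  fixes A1 A2 :: "complex ^ 'n ^ 'n"
  assumes "A1 ** A2 = A2 ** A1" "commutator (adj A1) A1 = commutator (adj A2) A2"
  shows "(adj A1 + mscale p A2) ** (adj A2 + mscale p A1) = (adj A2 + mscale p A1) ** (adj A1 + mscale p A2)"
proof -
  have "adj A1 ** A1 + A2 ** adj A2 = adj A2 ** A2 + A1 ** adj A1"
    using assms(2) by (simp add: commutator_def algebra_simps)
  then have 1: "mscale p (adj A1 ** A1) + mscale p (A2 ** adj A2) = mscale p (adj A2 ** A2) + mscale p (A1 ** adj A1)"
    by (metis mscale_add)
  have 2: "adj A1 ** adj A2 = adj A2 ** adj A1" by (metis assms(1) adj_mult)
  have rdistrib: "(A + B) ** C = A ** C + B ** C" for A B C :: "complex ^ 'n ^ 'n"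
    by (simp add: matrix_matrix_mult_def vec_eq_iff distrib_right sum.distrib)
  have "(adj A1 + mscale p A2) ** (adj A2 + mscale p A1) = adj A1 ** adj A2
      + (mscale p (adj A1 ** A1) + mscale p (A2 ** adj A2)) + mscale p (mscale p (A2 ** A1))"
    by (simp add: matrix_add_ldistrib rdistrib mscale_mult mscale_add algebra_simps)
  also have "\<dots> = (adj A2 + mscale p A1) ** (adj A1 + mscale p A2)"
    unfolding 1 2 assms(1)[symmetric]
    by (simp add: matrix_add_ldistrib rdistrib mscale_mult mscale_add algebra_simps)
  finally show ?thesis .
qed

lemma mat_mult_vec: "mat c *v v = c *s (v :: complex ^ 'n)"
  by (simp add: matrix_vector_mult_def mat_def vec_eq_iff if_distrib[of "\<lambda>x. x * _"] cong: if_cong)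

definition charpencil :: "complex ^ 'm ^ 'm \<Rightarrow> complex \<Rightarrow> complex \<Rightarrow> complex" where
  "charpencil F s p = det (adj F + mscale p F - mat s)"

lemma polynomial_fun_charpencil:
  assumes "polynomial_fun f" "polynomial_fun g"
  shows "polynomial_fun (\<lambda>x. charpencil F (f x) (g x))"
  unfolding charpencil_def
proof (rule polynomial_fun_det)
  fix i j
  have eq: "(\<lambda>x. (adj F + mscale (g x) F - mat (f x)) $ i $ j)
      = (\<lambda>x. (adj F $ i $ j + g x * F $ i $ j) + (if i = j then - 1 else 0) * f x)"
    by (auto simp: mscale_def mat_def)
  show "polynomial_fun (\<lambda>x. (adj F + mscale (g x) F - mat (f x)) $ i $ j)"
    unfolding eq using assms by (intro polynomial_fun_add polynomial_fun_mult polynomial_fun_const)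
qed

lemma continuous_on_charpencil:
  assumes "continuous_on S f" "continuous_on S g"
  shows "continuous_on S (\<lambda>x. charpencil F (f x) (g x))"
proof -
  have "charpencil F (f x) (g x) = (\<Sum>\<pi> | \<pi> permutes UNIV. of_int (sign \<pi>) *
      (\<Prod>i\<in>UNIV. cnj (F $ \<pi> i $ i) + g x * F $ i $ \<pi> i - (if i = \<pi> i then f x else 0)))" for x
    by (simp add: charpencil_def det_def adj_def mscale_def mat_def)
  moreover have "continuous_on S (\<lambda>x. if b then f x else 0)" for b using assms(1) by (cases b) auto
  ultimately show ?thesis using assms by (auto intro!: continuous_intros)
qed

lemma charpencil_root_exists: "\<exists>s. charpencil (F :: complex ^ 'm ^ 'm) s p = 0"
proof -
  obtain v r where "v \<noteq> 0" "(adj F + mscale p F) *v v = r *s v"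
    using invariant_subspace_has_eigenvector[of UNIV "adj F + mscale p F" "axis undefined 1"] by auto
  then have "charpencil F r p = 0"
    unfolding charpencil_def det_zero_iff_kernel
    by (auto simp: matrix_vector_mult_diff_rdistrib mat_mult_vec)
  then show ?thesis ..
qed

text \<open>
  Take for \<open>\<beta>\<close> the conjugate of the Rayleigh quotient of \<open>A1 + A2\<close> at an eigenvector.
\<close>

lemma pencil_sum_eigenvalue_form:
  fixes A1 A2 :: "complex ^ 'n ^ 'n"
  assumes small: "\<And>z. norm z = 1 \<Longrightarrow> opnorm (adj A1 + mscale z A2) < 1"
    and "charpencil (A1 + A2) s p = 0"
  shows "\<exists>\<beta>. norm \<beta> < 1 \<and> s = \<beta> + cnj \<beta> * p"
proof -
  obtain v where v: "v \<noteq> 0" "(adj (A1 + A2) + mscale p (A1 + A2) - mat s) *v v = 0"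
    using assms(2) unfolding charpencil_def det_zero_iff_kernel by blast
  then have "(adj (A1 + A2) + mscale p (A1 + A2)) *v v = s *s v"
    using v(2) by (simp add: matrix_vector_mult_diff_rdistrib mat_mult_vec)
  then have "s = cnj (rayleigh (A1 + A2) v) + p * rayleigh (A1 + A2) v"
    using rayleigh_eigenvector[OF v(1)] by (metis rayleigh_add rayleigh_adj rayleigh_mscale)
  moreover have "norm (rayleigh (A1 + A2) v) < 1"
    using rayleigh_sum_less_1[OF small] norm_triangle_ineq unfolding rayleigh_add
    by (rule le_less_trans[rotated])
  ultimately show ?thesis
    by (intro exI[of _ "cnj (rayleigh (A1 + A2) v)"]) (simp add: mult.commute)
qed

section \<open>The bidisc, the symmetrized bidisc and the tetrablock\<close>

lemma blaschke_identity:
  "(norm (1 - cnj \<beta> * z))\<^sup>2 - (norm (\<beta> - z))\<^sup>2 = (1 - (norm \<beta>)\<^sup>2) * (1 - (norm z)\<^sup>2)"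
  unfolding cmod_power2 by (simp add: power2_eq_square algebra_simps)

text \<open>
  The hypothesis says that \<open>w = (\<beta> - z) / (1 - \<beta>\<^sup>* z)\<close> with \<open>\<beta>\<^sup>*\<close> the conjugate of \<open>\<beta>\<close>, a Moebius
  transformation of the disc.
\<close>

lemma symmetrized_root_in_disc:
  assumes "norm \<beta> < 1" "z + w = \<beta> + cnj \<beta> * (z * w)" "norm z < 1"
  shows "norm w < 1"
proof -
  have eq: "w * (1 - cnj \<beta> * z) = \<beta> - z" using assms(2) by (simp add: algebra_simps)
  have "(norm (\<beta> - z))\<^sup>2 < (norm (1 - cnj \<beta> * z))\<^sup>2"
    using blaschke_identity[of \<beta> z] assms(1,3)
    by (smt (verit) mult_pos_pos norm_ge_zero power_less_one_iff zero_less_numeral)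
  then have lt: "norm (\<beta> - z) < norm (1 - cnj \<beta> * z)"
    by (rule power_less_imp_less_base) simp
  then have "norm w * norm (1 - cnj \<beta> * z) < 1 * norm (1 - cnj \<beta> * z)"
    using eq by (metis norm_mult mult_1)
  then show ?thesis by (rule mult_right_less_imp_less) simp
qed

lemma symmetrized_roots_in_disc:
  assumes "norm \<beta> < 1" "z + w = \<beta> + cnj \<beta> * (z * w)" "norm (z * w) < 1"
  shows "norm z < 1 \<and> norm w < 1"
proof -
  have "norm z < 1 \<or> norm w < 1"
    using assms(3) mult_mono[of 1 "norm z" 1 "norm w"] by (fastforce simp: norm_mult not_less)
  then show ?thesis
    using symmetrized_root_in_disc[OF assms(1), of z w] symmetrized_root_in_disc[OF assms(1), of w z] assms(2)
    by (auto simp: add.commute mult.commute)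
qed

lemma sum_product_solvable: "\<exists>z w. (s::complex) = z + w \<and> p = z * w"
proof -
  define d where "d = csqrt (s\<^sup>2 - 4 * p)"
  have "d\<^sup>2 = s\<^sup>2 - 4 * p" by (simp add: d_def)
  then have "s = (s + d) / 2 + (s - d) / 2" "p = (s + d) / 2 * ((s - d) / 2)"
    by (simp_all add: power2_eq_square field_simps)
  then show ?thesis by blast
qed

text \<open>
  If \<open>1 - z x1 - w x2 + z w x3\<close> vanishes, then \<open>|1 - w x2| \<le> |x1 - w x3|\<close> since \<open>|z| \<le> 1\<close>. The
  difference of the squares of the two sides has a lower bound that is quadratic in \<open>r = |w|\<close>. Its
  value at \<open>r \<le> 1\<close> is at least its value at \<open>r = 1\<close>, which is
  \<open>(1 - |p|\<^sup>2) ((1 - |b|)\<^sup>2 - |a|\<^sup>2) > 0\<close>.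
\<close>

lemma tetrablock_of_parameters:
  assumes x: "x $ 1 = a + cnj b * p" "x $ 2 = b + cnj a * p" "x $ 3 = p"
    and ab: "norm a + norm b < 1" and p: "norm p < 1"
  shows "x \<in> tetrablock"
  unfolding tetrablock_def
proof (intro CollectI allI impI notI)
  fix z w :: complex
  assume zw: "norm z \<le> 1 \<and> norm w \<le> 1" and 0: "1 - z * x $ 1 - w * x $ 2 + z * w * x $ 3 = 0"
  define x1 where "x1 = a + cnj b * p"
  define x2 where "x2 = b + cnj a * p"
  have "1 - w * x2 = z * (x1 - w * p)"
    using 0 unfolding x x1_def[symmetric] x2_def[symmetric] by (simp add: algebra_simps)
  then have "norm (1 - w * x2) \<le> norm (x1 - w * p)"
    using zw by (simp add: norm_mult mult_left_le_one_le)
  then have le: "(norm (1 - w * x2))\<^sup>2 \<le> (norm (x1 - w * p))\<^sup>2" by (simp add: power_mono)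
  define \<alpha> \<gamma> \<delta> r where defs: "\<alpha> = norm a" "\<gamma> = norm b" "\<delta> = norm p" "r = norm w"
  have pos: "0 \<le> \<alpha>" "0 \<le> \<gamma>" "0 \<le> \<delta>" "0 \<le> r" "\<alpha> + \<gamma> < 1" "\<delta> < 1" "r \<le> 1"
    using ab p zw by (simp_all add: defs)
  define X where "X = (norm x2)\<^sup>2 - \<delta>\<^sup>2"
  have expand: "(norm (1 - w * x2))\<^sup>2 - (norm (x1 - w * p))\<^sup>2
      = 1 - (norm x1)\<^sup>2 + r\<^sup>2 * X - 2 * Re (w * b) * (1 - \<delta>\<^sup>2)"
    unfolding X_def x1_def x2_def defs cmod_power2 by (simp add: power2_eq_square algebra_simps)
  have "Re (w * b) \<le> r * \<gamma>" unfolding defs using complex_Re_le_cmod by (metis norm_mult)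
  moreover have d2: "0 < 1 - \<delta>\<^sup>2" using pos by (simp add: power_less_one_iff)
  ultimately have "2 * Re (w * b) * (1 - \<delta>\<^sup>2) \<le> 2 * (r * \<gamma>) * (1 - \<delta>\<^sup>2)" by simp
  then have f: "1 - (norm x1)\<^sup>2 + r\<^sup>2 * X - 2 * r * \<gamma> * (1 - \<delta>\<^sup>2) \<le> 0"
    using le expand by (simp only: mult.assoc)
  \<comment> \<open>This bound on the quadratic coefficient is what makes the quadratic at least its value at \<open>r = 1\<close>.\<close>
  have X: "X \<le> \<gamma> * (1 - \<delta>\<^sup>2)"
  proof -
    have "norm x2 \<le> \<gamma> + \<alpha> * \<delta>"
      unfolding x2_def defs by (metis complex_mod_cnj norm_mult norm_triangle_ineq)
    also have "\<dots> \<le> \<gamma> + (1 - \<gamma>) * \<delta>" using pos by (intro add_left_mono mult_right_mono) auto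
    finally have "(norm x2)\<^sup>2 \<le> (\<gamma> + (1 - \<gamma>) * \<delta>)\<^sup>2" by (rule power_mono) simp
    then have "X \<le> (\<gamma> + (1 - \<gamma>) * \<delta>)\<^sup>2 - \<delta>\<^sup>2" by (simp add: X_def)
    also have "\<dots> = \<gamma> * (1 - \<delta>\<^sup>2) - \<gamma> * (1 - \<delta>) * ((1 - \<gamma>) * (1 - \<delta>))"
      by (simp add: power2_eq_square algebra_simps)
    also have "\<dots> \<le> \<gamma> * (1 - \<delta>\<^sup>2)" using pos by simp
    finally show ?thesis .
  qed
  have "(1 + r) * X \<le> 2 * (\<gamma> * (1 - \<delta>\<^sup>2))"
  proof (cases "X \<le> 0")
    case True
    then have "(1 + r) * X \<le> 0" using pos by (simp add: mult_nonneg_nonpos)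
    also have "0 \<le> 2 * (\<gamma> * (1 - \<delta>\<^sup>2))" using pos d2 by simp
    finally show ?thesis .
  next
    case False
    then have "(1 + r) * X \<le> 2 * X" using pos by (intro mult_right_mono) auto
    then show ?thesis using X by simp
  qed
  then have "0 \<le> (1 - r) * (2 * (\<gamma> * (1 - \<delta>\<^sup>2)) - (1 + r) * X)" using pos by simp
  then have "1 - (norm x1)\<^sup>2 + X - 2 * \<gamma> * (1 - \<delta>\<^sup>2) \<le> 1 - (norm x1)\<^sup>2 + r\<^sup>2 * X - 2 * r * \<gamma> * (1 - \<delta>\<^sup>2)"
    by (simp add: power2_eq_square algebra_simps)
  moreover have "1 - (norm x1)\<^sup>2 + X - 2 * \<gamma> * (1 - \<delta>\<^sup>2) = (1 - \<delta>\<^sup>2) * ((1 - \<gamma>)\<^sup>2 - \<alpha>\<^sup>2)"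
  proof -
    have "(norm x2)\<^sup>2 - (norm x1)\<^sup>2 = (\<gamma>\<^sup>2 - \<alpha>\<^sup>2) * (1 - \<delta>\<^sup>2)"
      unfolding x1_def x2_def defs cmod_power2 by (simp add: power2_eq_square algebra_simps)
    then show ?thesis unfolding X_def by (simp add: power2_eq_square algebra_simps)
  qed
  moreover have "0 < (1 - \<delta>\<^sup>2) * ((1 - \<gamma>)\<^sup>2 - \<alpha>\<^sup>2)"
  proof -
    have "\<alpha>\<^sup>2 < (1 - \<gamma>)\<^sup>2" using pos by (intro power_strict_mono) auto
    then show ?thesis using d2 by simp
  qed
  ultimately show False using f by linarith
qed

lemma sym_bidisc_iff: "y \<in> sym_bidisc \<longleftrightarrow> (\<exists>z w. norm z < 1 \<and> norm w < 1 \<and> y $ 1 = z + w \<and> y $ 2 = z * w)"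
proof
  assume "y \<in> sym_bidisc"
  then show "\<exists>z w. norm z < 1 \<and> norm w < 1 \<and> y $ 1 = z + w \<and> y $ 2 = z * w"
    by (auto simp: sym_bidisc_def bidisc_def sym_map_def)
next
  assume "\<exists>z w. norm z < 1 \<and> norm w < 1 \<and> y $ 1 = z + w \<and> y $ 2 = z * w"
  then obtain z w where "norm z < 1" "norm w < 1" "y $ 1 = z + w" "y $ 2 = z * w" by blast
  then have "vector [z, w] \<in> bidisc" "y = sym_map (vector [z, w])"
    by (auto simp: bidisc_def sym_map_def vec_eq_iff forall_2)
  then show "y \<in> sym_bidisc" by (auto simp: sym_bidisc_def)
qed

lemma continuous_on_sym_map: "continuous_on S sym_map"
proof -
  have eq: "sym_map = (\<lambda>z. axis 1 (z $ 1 + z $ 2) + axis 2 (z $ 1 * z $ 2))"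
    by (auto simp: sym_map_def fun_eq_iff vec_eq_iff forall_2 axis_def)
  have ax: "continuous_on S (\<lambda>x. axis i (f x) :: complex ^ 2)"
    if "continuous_on S f" for f :: "complex ^ 2 \<Rightarrow> complex" and i
    unfolding axis_def
  proof (rule continuous_on_vec_lambda)
    show "continuous_on S (\<lambda>x. if k = i then f x else 0)" for k
      using that by (cases "k = i") auto
  qed
  show ?thesis unfolding eq by (intro continuous_on_add ax continuous_intros)
qed

text \<open>
  Solving \<open>s = \<beta> + \<beta>\<^sup>* p\<close> for \<open>\<beta>\<close>, where \<open>\<beta>\<^sup>*\<close> is its conjugate, gives
  \<open>\<beta> = (s - s\<^sup>* p) / (1 - |p|\<^sup>2)\<close>, so points of this form with \<open>|\<beta>| < 1\<close> and \<open>|p| < 1\<close> are those of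
  the open set \<open>|s - s\<^sup>* p| < 1 - |p|\<^sup>2\<close>. The Moebius argument shows that both roots are in the disc.
\<close>

lemma interior_sym_bidisc:
  assumes "norm \<beta> < 1" "norm (y $ 2) < 1" "y $ 1 = \<beta> + cnj \<beta> * (y $ 2)"
  shows "y \<in> interior sym_bidisc"
proof -
  define U where "U = {y :: complex ^ 2. norm (y $ 1 - cnj (y $ 1) * y $ 2) < 1 - (norm (y $ 2))\<^sup>2}"
  have "open U" unfolding U_def by (intro open_Collect_less continuous_intros)
  moreover have "U \<subseteq> sym_bidisc"
  proof
    fix y assume "y \<in> U"
    define s p where sp: "s = y $ 1" "p = y $ 2"
    define t where "t = 1 - (norm p)\<^sup>2"
    have lt: "norm (s - cnj s * p) < t" using \<open>y \<in> U\<close> by (simp add: U_def sp t_def)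
    then have t: "t > 0" using norm_ge_zero by (rule le_less_trans[rotated])
    define b where "b = (s - cnj s * p) / of_real t"
    have b: "norm b < 1" using lt t by (simp add: b_def norm_divide)
    have "b + cnj b * p = (s - cnj s * p + cnj (s - cnj s * p) * p) / of_real t"
      by (simp add: b_def add_divide_distrib)
    also have "s - cnj s * p + cnj (s - cnj s * p) * p = s * of_real t"
    proof -
      have t_eq: "of_real t = 1 - p * cnj p"
        by (simp only: t_def of_real_diff of_real_1 complex_norm_square)
      show ?thesis unfolding t_eq by (simp add: algebra_simps)
    qed
    finally have s: "s = b + cnj b * p" using t by simp
    have p: "norm p < 1" using t by (simp add: t_def power_less_one_iff)
    obtain z w where zw: "s = z + w" "p = z * w" using sum_product_solvable by blast
    then have "norm z < 1 \<and> norm w < 1" using symmetrized_roots_in_disc[OF b, of z w] s p by simp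
    then show "y \<in> sym_bidisc" unfolding sym_bidisc_iff sp[symmetric] using zw by blast
  qed
  moreover have "y \<in> U"
  proof -
    have "y $ 1 - cnj (y $ 1) * y $ 2 = \<beta> * of_real (1 - (norm (y $ 2))\<^sup>2)"
      unfolding assms(3) of_real_diff of_real_1 complex_norm_square by (simp add: algebra_simps)
    moreover have "0 < 1 - (norm (y $ 2))\<^sup>2" using assms(2) by (simp add: power_less_one_iff)
    ultimately show ?thesis using assms(1) by (simp add: U_def norm_mult del: of_real_diff)
  qed
  ultimately show ?thesis by (meson interior_maximal subset_iff)
qed

definition closed_bidisc :: "(complex ^ 2) set" where
  "closed_bidisc = {z. norm (z $ 1) \<le> 1 \<and> norm (z $ 2) \<le> 1}"

lemma closure_bidisc: "closure bidisc = closed_bidisc"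
proof
  have "closed closed_bidisc"
    unfolding closed_bidisc_def by (intro closed_Collect_conj closed_Collect_le continuous_intros)
  moreover have "bidisc \<subseteq> closed_bidisc" by (auto simp: bidisc_def closed_bidisc_def)
  ultimately show "closure bidisc \<subseteq> closed_bidisc" by (rule closure_minimal[rotated])
  show "closed_bidisc \<subseteq> closure bidisc"
  proof
    fix z assume z: "z \<in> closed_bidisc"
    have "((\<lambda>n. (1 - inverse (real (Suc n))) *\<^sub>R z) \<longlonglongrightarrow> (1 - 0) *\<^sub>R z)"
      by (intro tendsto_intros LIMSEQ_inverse_real_of_nat)
    moreover have "(1 - inverse (real (Suc n))) *\<^sub>R z \<in> bidisc" for n
    proof -
      define r where "r = 1 - inverse (real (Suc n))"
      have r: "0 \<le> r" "r < 1" by (auto simp: r_def field_simps)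
      have "r * norm (z $ i) < 1" if "norm (z $ i) \<le> 1" for i
        using mult_left_le[OF that r(1)] r(2) by linarith
      then show ?thesis using z r unfolding r_def[symmetric] by (simp add: bidisc_def closed_bidisc_def)
    qed
    ultimately show "z \<in> closure bidisc"
      unfolding closure_sequential
      by (intro exI[of _ "\<lambda>n. (1 - inverse (real (Suc n))) *\<^sub>R z"]) simp
  qed
qed

lemma open_bidisc: "open bidisc"
  unfolding bidisc_def by (intro open_Collect_conj open_Collect_less continuous_intros)

lemma frontier_bidisc: "frontier bidisc = closed_bidisc - bidisc"
  using open_bidisc by (simp add: frontier_def closure_bidisc interior_open)

lemma closure_sym_bidisc: "closure sym_bidisc = sym_map ` closed_bidisc"
proof
  have "bounded closed_bidisc"
  proof (rule boundedI)
    fix x assume "x \<in> closed_bidisc"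
    moreover have "norm x \<le> (\<Sum>i\<in>UNIV. norm (x $ i))"
      unfolding norm_vec_def by (rule L2_set_le_sum) simp
    ultimately show "norm x \<le> 2" by (simp add: closed_bidisc_def UNIV_2)
  qed
  then have "compact closed_bidisc"
    using closure_bidisc closed_closure by (metis compact_eq_bounded_closed)
  then have "closed (sym_map ` closed_bidisc)"
    by (intro compact_imp_closed compact_continuous_image continuous_on_sym_map)
  moreover have "sym_bidisc \<subseteq> sym_map ` closed_bidisc"
    using closure_subset[of bidisc] by (auto simp: sym_bidisc_def closure_bidisc)
  ultimately show "closure sym_bidisc \<subseteq> sym_map ` closed_bidisc" by (rule closure_minimal[rotated])
  show "sym_map ` closed_bidisc \<subseteq> closure sym_bidisc"
    unfolding closure_bidisc[symmetric] sym_bidisc_def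
    by (rule image_closure_subset[OF continuous_on_sym_map]) (auto simp: closure_subset)
qed

text \<open>
  If \<open>u\<close> is a root of \<open>t\<^sup>2 - (x1 + x2) t + x3\<close> outside the open disc, then \<open>z = w = 1 / u\<close> makes the
  expression that defines the tetrablock vanish.
\<close>

lemma phi_map_tetrablock:
  assumes "x \<in> tetrablock" shows "phi_map x \<in> sym_bidisc"
proof -
  obtain z w where zw: "x $ 1 + x $ 2 = z + w" "x $ 3 = z * w" using sum_product_solvable by blast
  have nonzero: "1 - u * x $ 1 - w * x $ 2 + u * w * x $ 3 \<noteq> 0" if "norm u \<le> 1" "norm w \<le> 1" for u w
    using assms that by (simp add: tetrablock_def)
  have "norm u < 1" if "x $ 1 + x $ 2 = u + v" "x $ 3 = u * v" for u v
  proof (rule ccontr)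
    assume u: "\<not> norm u < 1"
    then have "u \<noteq> 0" by auto
    have "1 - 1 / u * x $ 1 - 1 / u * x $ 2 + 1 / u * (1 / u) * x $ 3 = 1 - (x $ 1 + x $ 2) / u + x $ 3 / u / u"
      by (simp add: add_divide_distrib)
    also have "\<dots> = 0" unfolding that using \<open>u \<noteq> 0\<close> by (simp add: add_divide_distrib)
    finally show False
      using nonzero[of "1 / u" "1 / u"] u \<open>u \<noteq> 0\<close> by (simp add: norm_divide divide_le_eq)
  qed
  from this[of z w] this[of w z] have "norm z < 1" "norm w < 1"
    using zw by (simp_all add: add.commute mult.commute)
  then show ?thesis
    unfolding sym_bidisc_iff using zw by (intro exI[of _ z] exI[of _ w]) (simp add: phi_map_def)
qed

section \<open>The curves in the symmetrized bidisc and in the bidisc\<close>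

lemma closure_within_zero_set:
  fixes f :: "'a::topological_space \<Rightarrow> complex"
  assumes "continuous_on UNIV f" "\<And>x. x \<in> S \<Longrightarrow> f x = 0" "x \<in> closure S"
  shows "f x = 0"
proof -
  have "closed {x. f x = 0}" using assms(1) by (intro closed_Collect_eq continuous_on_const)
  then have "closure S \<subseteq> {x. f x = 0}" using assms(2) by (intro closure_minimal) auto
  then show ?thesis using assms(3) by blast
qed

text \<open>
  The property of \<open>F = A1 + A2\<close> on which the geometry of the two curves depends; it stands in for the
  norm bound on the circle.
\<close>

locale contractive_pencil =
  fixes F :: "complex ^ 'm ^ 'm"
  assumes root_form: "charpencil F s p = 0 \<Longrightarrow> \<exists>\<beta>. norm \<beta> < 1 \<and> s = \<beta> + cnj \<beta> * p"
begin

definition W where "W = {y :: complex ^ 2. norm (y $ 2) < 1 \<and> charpencil F (y $ 1) (y $ 2) = 0}"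

definition V where "V = {z \<in> bidisc. charpencil F (z $ 1 + z $ 2) (z $ 1 * z $ 2) = 0}"

lemma W_subset_interior: "W \<subseteq> interior sym_bidisc"
  using root_form interior_sym_bidisc by (fastforce simp: W_def)

lemma W_eq: "W = sym_bidisc \<inter> {y. charpencil F (y $ 1) (y $ 2) = 0}"
proof
  show "W \<subseteq> sym_bidisc \<inter> {y. charpencil F (y $ 1) (y $ 2) = 0}"
    using W_subset_interior interior_subset by (auto simp: W_def)
  have "norm (y $ 2) < 1" if y: "y \<in> sym_bidisc" for y
  proof -
    obtain z w where "norm z < 1" "norm w < 1" "y $ 2 = z * w"
      using y unfolding sym_bidisc_iff by blast
    then show ?thesis using mult_strict_mono[of "norm z" 1 "norm w" 1] by (simp add: norm_mult)
  qed
  then show "sym_bidisc \<inter> {y. charpencil F (y $ 1) (y $ 2) = 0} \<subseteq> W" by (auto simp: W_def)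
qed

lemma sym_map_V: "sym_map ` V = W"
proof
  show "sym_map ` V \<subseteq> W" unfolding W_eq V_def by (auto simp: sym_bidisc_def) (simp add: sym_map_def)
  show "W \<subseteq> sym_map ` V"
  proof
    fix y assume y: "y \<in> W"
    then obtain z where "z \<in> bidisc" "y = sym_map z" unfolding W_eq sym_bidisc_def by blast
    then show "y \<in> sym_map ` V" using y by (auto simp: W_def V_def sym_map_def)
  qed
qed

text \<open>
  This keeps roots bounded when the first coordinate is the parameter, and shows that no point of the
  curve has exactly one coordinate in the disc.
\<close>

lemma V_root_bound:
  assumes "norm z < 1" "charpencil F (z + w) (z * w) = 0" shows "norm w < 1"
  using root_form[OF assms(2)] symmetrized_root_in_disc[of _ z w] assms(1) by blast

lemma complex_dim_W: "complex_dim W > 0"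
proof -
  \<comment> \<open>The determinant as a polynomial in \<open>s\<close> over polynomials in \<open>p\<close>.\<close>
  define Q where "Q = det (\<chi> i j. [:[:cnj (F $ j $ i), F $ i $ j:], [:if i = j then - 1 else 0:]:])"
  have Q: "poly2 Q s p = charpencil F s p" for s p
    unfolding Q_def poly2_det charpencil_def
    by (rule arg_cong[of _ _ det]) (simp add: vec_eq_iff adj_def mscale_def mat_def)
  obtain s0 where "charpencil F s0 0 = 0" using charpencil_root_exists by blast
  moreover have "norm s < 2" if sp: "p \<in> ball 0 1" "charpencil F s p = 0" for s p
  proof -
    obtain \<beta> where b: "norm \<beta> < 1" "s = \<beta> + cnj \<beta> * p" using root_form[OF sp(2)] by blast
    have "norm s \<le> norm \<beta> + norm \<beta> * norm p"
      unfolding b(2) by (metis complex_mod_cnj norm_mult norm_triangle_ineq)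
    moreover have "norm \<beta> * norm p \<le> norm \<beta>" using sp by (simp add: mult_left_le)
    ultimately show ?thesis using b(1) by linarith
  qed
  ultimately have "\<exists>h p0 r. r > 0 \<and> ball p0 r \<subseteq> ball 0 1 \<and>
      (\<forall>p\<in>ball p0 r. charpencil F (h p) p = 0 \<and> h field_differentiable (at p))"
    by (intro root_branch_of_bounded_roots[of _ 0 Q s0 2, unfolded Q]) auto
  then obtain h p0 r where h: "r > 0" "ball p0 r \<subseteq> ball 0 1"
    "\<And>p. p \<in> ball p0 r \<Longrightarrow> charpencil F (h p) p = 0 \<and> h field_differentiable (at p)"
    by blast
  define M where "M = {y :: complex ^ 2. y $ 2 \<in> ball p0 r \<and> y $ 1 = h (y $ 2)}"
  have "complex_submanifold 1 M"
    unfolding M_def using h by (intro graph_complex_submanifold) (auto simp: UNIV_2)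
  moreover have "vector [h p0, p0] \<in> M" using h by (simp add: M_def)
  moreover have "M \<subseteq> W" using h by (auto simp: M_def W_def)
  ultimately show ?thesis using complex_dim_pos by blast
qed

lemma complex_dim_V: "complex_dim V > 0"
proof -
  \<comment> \<open>The determinant as a polynomial in the second coordinate over polynomials in the first.\<close>
  define Q where "Q = det (\<chi> i j. [:[:cnj (F $ j $ i), if i = j then - 1 else 0:],
      [:if i = j then - 1 else 0, F $ i $ j:]:])"
  have Q: "poly2 Q w z = charpencil F (z + w) (z * w)" for z w
    unfolding Q_def poly2_det charpencil_def
    by (rule arg_cong[of _ _ det]) (simp add: vec_eq_iff adj_def mscale_def mat_def algebra_simps)
  have "W \<noteq> {}"
  proof -
    obtain s0 where "charpencil F s0 0 = 0" using charpencil_root_exists by blast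
    then have "vector [s0, 0] \<in> W" by (simp add: W_def)
    then show ?thesis by blast
  qed
  then obtain z where "z \<in> V" using sym_map_V by blast
  then have "\<exists>h p0 r. r > 0 \<and> ball p0 r \<subseteq> ball 0 1 \<and>
      (\<forall>p\<in>ball p0 r. charpencil F (p + h p) (p * h p) = 0 \<and> h field_differentiable (at p))"
    using V_root_bound
    by (intro root_branch_of_bounded_roots[of _ "z $ 1" Q "z $ 2" 1, unfolded Q]) (auto simp: V_def bidisc_def)
  then obtain h p0 r where h: "r > 0" "ball p0 r \<subseteq> ball 0 1"
    "\<And>p. p \<in> ball p0 r \<Longrightarrow> charpencil F (p + h p) (p * h p) = 0 \<and> h field_differentiable (at p)"
    by blast
  define M where "M = {y :: complex ^ 2. y $ 1 \<in> ball p0 r \<and> y $ 2 = h (y $ 1)}"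
  have "complex_submanifold 1 M"
    unfolding M_def using h by (intro graph_complex_submanifold) (auto simp: UNIV_2)
  moreover have "vector [p0, h p0] \<in> M" using h by (simp add: M_def)
  moreover have "M \<subseteq> V"
  proof
    fix y assume "y \<in> M"
    then have "norm (y $ 1) < 1" "charpencil F (y $ 1 + y $ 2) (y $ 1 * y $ 2) = 0"
      using h by (auto simp: M_def)
    then show "y \<in> V" using V_root_bound by (auto simp: V_def bidisc_def)
  qed
  ultimately show ?thesis using complex_dim_pos by blast
qed

text \<open>
  A boundary point in the closure of \<open>W\<close> still satisfies the equation. If \<open>|p| < 1\<close>, it lies in \<open>W\<close> and
  hence in the interior. So \<open>|p| = 1\<close>, and since both roots lie in the closed disc, both are unimodular.
\<close>

lemma distinguished_variety_W: "distinguished_variety sym_bidisc sym_bidisc_dbdry W"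
  unfolding distinguished_variety_def
proof (intro conjI)
  show "variety_in sym_bidisc W"
    unfolding variety_in_def W_eq
    by (intro exI[of _ "{\<lambda>y. charpencil F (y $ 1) (y $ 2)}"])
       (auto intro: polynomial_fun_charpencil polynomial_fun_coord)
  show "complex_dim W > 0" by (rule complex_dim_W)
  have "y \<in> sym_bidisc_dbdry" if y: "y \<in> closure W" "y \<in> frontier sym_bidisc" for y
  proof -
    have "y \<in> closure sym_bidisc" using y(2) by (simp add: frontier_def)
    then obtain z where z: "z \<in> closed_bidisc" "y = sym_map z" unfolding closure_sym_bidisc by blast
    have "charpencil F (y $ 1) (y $ 2) = 0"
      using y(1) by (rule closure_within_zero_set[rotated 2])
         (auto simp: W_def intro!: continuous_on_charpencil continuous_intros)
    then have "\<not> norm (y $ 2) < 1"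
      using y(2) W_subset_interior by (auto simp: frontier_def W_def)
    then have "1 \<le> norm (z $ 1) * norm (z $ 2)" by (simp add: z(2) sym_map_def norm_mult)
    then have "norm (z $ 1) = 1 \<and> norm (z $ 2) = 1"
      using z(1) mult_left_le[of "norm (z $ 2)" "norm (z $ 1)"] mult_left_le[of "norm (z $ 1)" "norm (z $ 2)"]
      by (simp add: closed_bidisc_def mult.commute)
    then show ?thesis using z by (auto simp: sym_bidisc_dbdry_def bidisc_dbdry_def)
  qed
  moreover have "sym_bidisc_dbdry \<subseteq> frontier sym_bidisc"
  proof
    fix y assume "y \<in> sym_bidisc_dbdry"
    then obtain z where z: "z \<in> bidisc_dbdry" "y = sym_map z" by (auto simp: sym_bidisc_dbdry_def)
    then have "y \<in> closure sym_bidisc"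
      unfolding closure_sym_bidisc by (auto simp: bidisc_dbdry_def closed_bidisc_def)
    moreover have "norm (y $ 2) = 1" using z by (simp add: sym_map_def norm_mult bidisc_dbdry_def)
    then have "y \<notin> sym_bidisc"
      using mult_strict_mono[of "norm _" 1 "norm _" 1]
      unfolding sym_bidisc_iff by (metis norm_ge_zero norm_mult mult_1 order_less_irrefl zero_less_one)
    ultimately show "y \<in> frontier sym_bidisc"
      using interior_subset by (auto simp: frontier_def)
  qed
  ultimately show "closure W \<inter> frontier sym_bidisc = closure W \<inter> sym_bidisc_dbdry" by blast
qed

text \<open>
  At a boundary point in the closure of \<open>V\<close> both coordinates lie in the closed disc but not both in
  the open disc, hence by \<open>V_root_bound\<close> neither does.
\<close>

lemma distinguished_variety_V: "distinguished_variety bidisc bidisc_dbdry V"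
  unfolding distinguished_variety_def
proof (intro conjI)
  show "variety_in bidisc V"
    unfolding variety_in_def V_def
    by (intro exI[of _ "{\<lambda>z. charpencil F (z $ 1 + z $ 2) (z $ 1 * z $ 2)}"])
       (auto intro!: polynomial_fun_charpencil polynomial_fun_coord polynomial_fun_add polynomial_fun_mult)
  show "complex_dim V > 0" by (rule complex_dim_V)
  have "z \<in> bidisc_dbdry" if z: "z \<in> closure V" "z \<in> frontier bidisc" for z
  proof -
    have 0: "charpencil F (z $ 1 + z $ 2) (z $ 1 * z $ 2) = 0"
      using z(1) by (rule closure_within_zero_set[rotated 2])
         (auto simp: V_def intro!: continuous_on_charpencil continuous_intros)
    then have "norm (z $ 1) < 1 \<longleftrightarrow> norm (z $ 2) < 1"
      using V_root_bound by (metis add.commute mult.commute)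
    then show ?thesis
      using z(2) unfolding frontier_bidisc by (auto simp: closed_bidisc_def bidisc_def bidisc_dbdry_def)
  qed
  moreover have "bidisc_dbdry \<subseteq> frontier bidisc"
    unfolding frontier_bidisc by (auto simp: closed_bidisc_def bidisc_def bidisc_dbdry_def)
  ultimately show "closure V \<inter> frontier bidisc = closure V \<inter> bidisc_dbdry" by blast
qed

end

section \<open>The image of the variety in the tetrablock\<close>

text \<open>
  The joint eigenvalues of \<open>S(p)\<close> and \<open>T(p)\<close> add up to eigenvalues of \<open>S(p) + T(p)\<close>. Conversely, an
  eigenvalue of the sum comes from a joint eigenvector, and the Rayleigh quotients of \<open>A1\<close> and \<open>A2\<close> at
  this vector are parameters that put the pair of joint eigenvalues into the tetrablock.
\<close>

lemma phi_image_of_spectral_variety: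
  fixes A1 A2 :: "complex ^ 'm ^ 'm"
  assumes "A1 ** A2 = A2 ** A1" "commutator (adj A1) A1 = commutator (adj A2) A2"
    and small: "\<And>z. norm z = 1 \<Longrightarrow> opnorm (adj A1 + mscale z A2) < 1"
  shows "phi_map ` {x \<in> tetrablock. (x $ 1, x $ 2) \<in>
           taylor_spectrum (adj A1 + mscale (x $ 3) A2) (adj A2 + mscale (x $ 3) A1)}
         = sym_bidisc \<inter> {y. charpencil (A1 + A2) (y $ 1) (y $ 2) = 0}" (is "phi_map ` ?\<Omega> = ?W")
proof -
  define S where "S = (\<lambda>p. adj A1 + mscale p A2)"
  define T where "T = (\<lambda>p. adj A2 + mscale p A1)"
  have comm: "S p ** T p = T p ** S p" for p
    unfolding S_def T_def by (rule pencils_commute[OF assms(1,2)])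
  have sum: "S p + T p = adj (A1 + A2) + mscale p (A1 + A2)" for p
    by (simp add: S_def T_def adj_add mscale_add)
  have char: "charpencil (A1 + A2) s p = 0 \<longleftrightarrow> (\<exists>v. v \<noteq> 0 \<and> (S p + T p) *v v = s *s v)" for s p
    unfolding charpencil_def det_zero_iff_kernel sum
    by (simp add: matrix_vector_mult_diff_rdistrib mat_mult_vec)
  have spec: "taylor_spectrum (S p) (T p) = {(a, b). \<exists>v. v \<noteq> 0 \<and> S p *v v = a *s v \<and> T p *v v = b *s v}" for p
    by (rule taylor_spectrum_eq_joint_eigenvalues[OF comm])
  have \<Omega>: "?\<Omega> = {x \<in> tetrablock. \<exists>v. v \<noteq> 0 \<and> S (x $ 3) *v v = x $ 1 *s v \<and> T (x $ 3) *v v = x $ 2 *s v}"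
    using spec by (simp add: S_def T_def)
  show ?thesis unfolding \<Omega>
  proof (intro equalityI subsetI)
    fix y assume "y \<in> phi_map ` {x \<in> tetrablock. \<exists>v. v \<noteq> 0 \<and> S (x $ 3) *v v = x $ 1 *s v \<and> T (x $ 3) *v v = x $ 2 *s v}"
    then obtain x v where x: "x \<in> tetrablock" "y = phi_map x" "v \<noteq> 0"
      "S (x $ 3) *v v = x $ 1 *s v" "T (x $ 3) *v v = x $ 2 *s v" by blast
    then have "(S (x $ 3) + T (x $ 3)) *v v = (x $ 1 + x $ 2) *s v"
      by (simp add: matrix_vector_mult_add_rdistrib vec.scale_left_distrib)
    then show "y \<in> ?W" using x phi_map_tetrablock[OF x(1)] char by (auto simp: phi_map_def)
  next
    fix y assume y: "y \<in> ?W"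
    define s p where sp: "s = y $ 1" "p = y $ 2"
    obtain v where "v \<noteq> 0" "(S p + T p) *v v = s *s v" using y char by (auto simp: sp)
    then obtain w a b where w: "w \<noteq> 0" "S p *v w = a *s w" "T p *v w = b *s w" "a + b = s"
      using joint_eigenvector_of_sum[OF comm] by blast
    define \<alpha> \<beta> where ab: "\<alpha> = cnj (rayleigh A1 w)" "\<beta> = cnj (rayleigh A2 w)"
    define x where "x = (vector [a, b, p] :: complex ^ 3)"
    have x: "x $ 1 = a" "x $ 2 = b" "x $ 3 = p" by (simp_all add: x_def)
    have "x \<in> tetrablock"
    proof (rule tetrablock_of_parameters[of x \<alpha> \<beta> p])
      show "x $ 1 = \<alpha> + cnj \<beta> * p" "x $ 2 = \<beta> + cnj \<alpha> * p"
        using rayleigh_eigenvector[OF w(1,2)] rayleigh_eigenvector[OF w(1,3)]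
        by (simp_all add: x ab S_def T_def rayleigh_add rayleigh_adj rayleigh_mscale mult.commute)
      show "norm \<alpha> + norm \<beta> < 1" using rayleigh_sum_less_1[OF small] by (simp add: ab)
      obtain z1 z2 where "norm z1 < 1" "norm z2 < 1" "p = z1 * z2"
        using y unfolding sp Int_iff sym_bidisc_iff by blast
      then show "norm p < 1" using mult_strict_mono[of "norm z1" 1 "norm z2" 1] by (simp add: norm_mult)
    qed (rule x)
    moreover have "y = phi_map x" using w(4) by (simp add: phi_map_def x vec_eq_iff forall_2 sp)
    ultimately show "y \<in> phi_map ` {x \<in> tetrablock. \<exists>v. v \<noteq> 0 \<and> S (x $ 3) *v v = x $ 1 *s v \<and> T (x $ 3) *v v = x $ 2 *s v}"
      using w x by blast
  qed
qed

theorem theorem5p5: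
  fixes A1 A2 :: "complex ^ 'm ^ 'm" and \<Omega> :: "(complex ^ 3) set" and W :: "(complex ^ 2) set"
  assumes "A1 ** A2 = A2 ** A1"
    and "commutator (adj A1) A1 = commutator (adj A2) A2"
    and "\<Omega> = {x \<in> tetrablock. (x $ 1, x $ 2) \<in>
               taylor_spectrum (adj A1 + mscale (x $ 3) A2) (adj A2 + mscale (x $ 3) A1)}"
    and "distinguished_variety tetrablock tetrablock_dbdry \<Omega>"
    and "(SUP z\<in>sphere 0 1. opnorm (adj A1 + mscale z A2)) < 1"
    and "W = phi_map ` \<Omega>"
  shows "distinguished_variety sym_bidisc sym_bidisc_dbdry W \<and>
         (\<exists>V. distinguished_variety bidisc bidisc_dbdry V \<and> sym_map ` V = W)"
proof -
  have small: "opnorm (adj A1 + mscale z A2) < 1" if "norm z = 1" for z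
    using opnorm_less_of_SUP_less[OF assms(5) that] .
  interpret P: contractive_pencil "A1 + A2"
    using pencil_sum_eigenvalue_form[OF small] by unfold_locales
  have "W = P.W"
    unfolding assms(6) assms(3) P.W_eq by (rule phi_image_of_spectral_variety[OF assms(1,2) small])
  then show ?thesis using P.distinguished_variety_W P.distinguished_variety_V P.sym_map_V by blast
qed

end
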